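(* For large enough integers $d,n$ with $\omega(\log n)=d\leq n$, there is a polynomial $G_{n,d}(X)$ which is set-multilinear over the variable partition $X=(X_1,\ldots,X_d)$ with each $|X_i|\leq n$, such that: (i) $G_{n,d}$ has an algebraic branching program of size $\mathrm{poly}(n)$; but (ii) any $\sum\mathsf{smABP}$ of max-width $\mathrm{poly}(n)$ computing $G_{n,d}$ requires total-width $2^{\Omega(d)}$.
   Context: An algebraic branching program (ABP) is a layered DAG with a start node and an end node, edges between consecutive layers labelled by linear polynomials, computing the sum over start-to-end paths of the product of edge labels; its size is its number of nodes. A polynomial is set-multilinear with respect to a partition $(X_1,\ldots,X_d)$ if every monomial contains exactly one variable from each $X_i$. A set-multilinear ABP of depth $d$ is ordered with respect to $\sigma\in S_d$ if every edge from layer $\ell-1$ to layer $\ell$ is labelled by a linear form in the variables of $X_{\sigma(\ell)}$; its width is the maximum number of nodes in a layer. A $\sum\mathsf{smABP}$ computing $P$ is an expression $\sum_{i=1}^t A_i=P$ with each $A_i$ a set-multilinear ABP ordered with respect to some permutation $\sigma_i$; its max-width is the maximum width of the $A_i$ and its total-width is the sum of the widths. *)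

theory Defs
  imports Complex_Main "HOL-Library.Poly_Mapping" "HOL-Combinatorics.Permutations"
begin

text \<open>Multivariate polynomials over a field 'k in variables indexed by nat:
  a monomial is a finitely supported exponent vector finitely supported map nat to nat, a polynomial
  is a finitely supported map from monomials to coefficients (convolution product).\<close>
type_synonym 'k mpoly = "(nat \<Rightarrow>\<^sub>0 nat) \<Rightarrow>\<^sub>0 'k"

definition Var :: "nat \<Rightarrow> 'k::comm_ring_1 mpoly" where
  "Var v = Poly_Mapping.single (Poly_Mapping.single v 1) 1"

definition Const :: "'k::comm_ring_1 \<Rightarrow> 'k mpoly" where
  "Const c = Poly_Mapping.single 0 c"

definition is_linear_poly :: "'k::comm_ring_1 mpoly \<Rightarrow> bool" where
  "is_linear_poly p \<longleftrightarrow>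
     (\<exists>c a V. finite V \<and> p = Const c + (\<Sum>v\<in>V. Const (a v) * Var v))"

definition is_linear_form_in :: "nat set \<Rightarrow> 'k::comm_ring_1 mpoly \<Rightarrow> bool" where
  "is_linear_form_in V p \<longleftrightarrow> (\<exists>a. p = (\<Sum>v\<in>V. Const (a v) * Var v))"

text \<open>An ABP is a triple (m, w, L): m \<ge> 1 is the number of edge layers
  (node layers 0..m), w l is the number of nodes in node layer l
  (w 0 = w m = 1: start and end node), and L l i j is the label of the edge
  from node i of layer l-1 to node j of layer l (label 0 = no edge).\<close>
type_synonym 'k abp = "nat \<times> (nat \<Rightarrow> nat) \<times> (nat \<Rightarrow> nat \<Rightarrow> nat \<Rightarrow> 'k mpoly)"

fun abp_val :: "(nat \<Rightarrow> nat) \<Rightarrow> (nat \<Rightarrow> nat \<Rightarrow> nat \<Rightarrow> 'k::comm_ring_1 mpoly) \<Rightarrow> nat \<Rightarrow> nat \<Rightarrow> 'k mpoly" where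
  "abp_val w L 0 j = (if j = 0 then 1 else 0)"
| "abp_val w L (Suc l) j = (\<Sum>i<w l. abp_val w L l i * L (Suc l) i j)"

definition abp_poly :: "'k::comm_ring_1 abp \<Rightarrow> 'k mpoly" where
  "abp_poly A = (case A of (m, w, L) \<Rightarrow> abp_val w L m 0)"

definition abp_wf :: "'k::comm_ring_1 abp \<Rightarrow> bool" where
  "abp_wf A = (case A of (m, w, L) \<Rightarrow>
     1 \<le> m \<and> w 0 = 1 \<and> w m = 1 \<and>
     (\<forall>l\<in>{1..m}. \<forall>i<w (l - 1). \<forall>j<w l. is_linear_poly (L l i j)))"

definition abp_size :: "'k abp \<Rightarrow> nat" where
  "abp_size A = (case A of (m, w, L) \<Rightarrow> \<Sum>l\<le>m. w l)"

definition abp_width :: "'k abp \<Rightarrow> nat" where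
  "abp_width A = (case A of (m, w, L) \<Rightarrow> Max (w ` {..m}))"

definition sm_abp :: "nat set list \<Rightarrow> (nat \<Rightarrow> nat) \<Rightarrow> 'k::comm_ring_1 abp \<Rightarrow> bool" where
  "sm_abp X \<sigma> A = (case A of (m, w, L) \<Rightarrow>
     abp_wf A \<and> m = length X \<and> \<sigma> permutes {..<length X} \<and>
     (\<forall>l\<in>{1..m}. \<forall>i<w (l - 1). \<forall>j<w l. is_linear_form_in (X ! \<sigma> (l - 1)) (L l i j)))"

definition sum_smabp :: "nat set list \<Rightarrow> 'k::comm_ring_1 abp list \<Rightarrow> bool" where
  "sum_smabp X As \<longleftrightarrow> (\<forall>A\<in>set As. \<exists>\<sigma>. sm_abp X \<sigma> A)"

definition sum_abp_poly :: "'k::comm_ring_1 abp list \<Rightarrow> 'k mpoly" where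
  "sum_abp_poly As = (\<Sum>A\<leftarrow>As. abp_poly A)"

definition sm_max_width :: "'k abp list \<Rightarrow> nat" where
  "sm_max_width As = Max (insert 0 (abp_width ` set As))"

definition sm_total_width :: "'k abp list \<Rightarrow> nat" where
  "sm_total_width As = (\<Sum>A\<leftarrow>As. abp_width A)"

definition is_var_partition :: "nat \<Rightarrow> nat set list \<Rightarrow> bool" where
  "is_var_partition n X \<longleftrightarrow>
     (\<forall>i<length X. finite (X ! i) \<and> card (X ! i) \<le> n) \<and>
     (\<forall>i<length X. \<forall>j<length X. i \<noteq> j \<longrightarrow> X ! i \<inter> X ! j = {})"

definition set_multilinear :: "nat set list \<Rightarrow> ((nat \<Rightarrow>\<^sub>0 nat) \<Rightarrow>\<^sub>0 'k::zero) \<Rightarrow> bool" where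
  "set_multilinear X p \<longleftrightarrow>
     (\<forall>\<mu> \<in> Poly_Mapping.keys p.
        (\<forall>v \<in> Poly_Mapping.keys \<mu>. v \<in> \<Union>(set X)) \<and>
        (\<forall>i<length X. (\<Sum>v\<in>X ! i. Poly_Mapping.lookup \<mu> v) = 1))"

end

(* Let h = d div 2 and let the letter 0 mean "skip". The polynomial is the sum of the monomials of all
   words of length d over {0,...,n-1} whose two halves agree after deleting the letter 0. A program
   with a pointer into each half and one pending letter computes it: it reads the next letter of the
   first half and, if this is not 0, moves on in the second half until it meets the same letter.

   Lower bound: choose subsets U, V of the two halves with |U| = |V| = p and keep only the words that
   are nonzero exactly on U and V. The coefficient matrix (letters on U against letters on V) is an
   identity matrix of size (n-1)^p. Cut the order of a set-multilinear ABP of width at most n^c into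
   q+1 blocks of constant length b. The matrix of the ABP has rank at most n^(c(q+1)) (n-1)^s, where
   s is the sum over the blocks B of min(|U \<inter> B|, |V \<inter> B|). With U = W \<inter> {..<h} and V = {h..<d} - W for
   a random set W with |W| = d - h, the blocks are balanced independently and rarely, up to the
   conditioning on |W|, which costs a factor d + 1. So, except with probability about (d+1) 2^(-q), the
   loss p - s is at least (4c+1)q, which beats the width. A union bound yields one W for all summands
   if there are few of them, and then the ranks cannot add up to (n-1)^p. *)

theory Submission
  imports Defs "HOL-Library.FuncSet" "HOL-Real_Asymp.Real_Asymp"
begin

section \<open>Matrix rank\<close>

text \<open>Rank as the number of terms \<open>u y * v z\<close> in a decomposition of
  \<open>M\<close> on \<open>I\<close> and \<open>J\<close>. In this form sums and entrywise
  products are bounded by combining decompositions, and linear algebra enters only in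
  \<open>rank_le_identity\<close>.\<close>

definition rank_le :: "nat \<Rightarrow> 'y set \<Rightarrow> 'z set \<Rightarrow> ('y \<Rightarrow> 'z \<Rightarrow> 'k::field) \<Rightarrow> bool" where
  "rank_le r I J M \<longleftrightarrow>
     (\<exists>u v. \<forall>y\<in>I. \<forall>z\<in>J. M y z = (\<Sum>k<r. u (k::nat) y * v k z))"

lemma rank_leI:
  fixes M :: "'y \<Rightarrow> 'z \<Rightarrow> 'k::field"
  assumes "finite K" "card K \<le> r"
    and "\<And>y z. y \<in> I \<Longrightarrow> z \<in> J \<Longrightarrow> M y z = (\<Sum>k\<in>K. u k y * v k z)"
  shows "rank_le r I J M"
proof -
  obtain h where h: "bij_betw h {0..<card K} K"
    using ex_bij_betw_nat_finite[OF assms(1)] by blast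
  define u' where "u' k = (if k < card K then u (h k) else (\<lambda>_. 0))" for k
  have "M y z = (\<Sum>k<r. u' k y * v (h k) z)" if "y \<in> I" "z \<in> J" for y z
  proof -
    have "(\<Sum>k<r. u' k y * v (h k) z) = (\<Sum>k\<in>{0..<card K}. u' k y * v (h k) z)"
      using assms(2) by (intro sum.mono_neutral_right) (auto simp: u'_def)
    also have "\<dots> = (\<Sum>k\<in>{0..<card K}. u (h k) y * v (h k) z)"
      by (intro sum.cong) (auto simp: u'_def)
    also have "\<dots> = (\<Sum>k\<in>K. u k y * v k z)"
      by (rule sum.reindex_bij_betw[OF h])
    finally show ?thesis using assms(3)[OF that] by simp
  qed
  then show ?thesis
    unfolding rank_le_def by (intro exI[of _ u'] exI[of _ "\<lambda>k. v (h k)"]) blast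
qed

lemma rank_le_sum:
  assumes "finite S" "\<And>i. i \<in> S \<Longrightarrow> rank_le r I J (M i)"
  shows "rank_le (card S * r) I J (\<lambda>y z. \<Sum>i\<in>S. M i y z)"
proof -
  have "\<forall>i\<in>S. \<exists>u v. \<forall>y\<in>I. \<forall>z\<in>J. M i y z = (\<Sum>k<r. u (k::nat) y * v k z)"
    using assms(2) by (auto simp: rank_le_def)
  then obtain u v where uv: "\<And>i y z. i \<in> S \<Longrightarrow> y \<in> I \<Longrightarrow> z \<in> J \<Longrightarrow>
      M i y z = (\<Sum>k<r. u i (k::nat) y * v i k z)"
    by metis
  show ?thesis
  proof (rule rank_leI[where K = "S \<times> {..<r}"])
    fix y z assume "y \<in> I" "z \<in> J"
    then show "(\<Sum>i\<in>S. M i y z) = (\<Sum>k\<in>S \<times> {..<r}. u (fst k) (snd k) y * v (fst k) (snd k) z)"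
      by (simp add: uv sum.cartesian_product case_prod_unfold)
  qed (use assms(1) in \<open>auto simp: card_cartesian_product\<close>)
qed

text \<open>The product is entrywise: a term \<open>u y * v z\<close> of one factor times a term of
  the other again splits into a function of \<open>y\<close> times a function of
  \<open>z\<close>.\<close>

lemma rank_le_mult:
  assumes "rank_le r I J M" "rank_le s I J N"
  shows "rank_le (r * s) I J (\<lambda>y z. M y z * N y z)"
proof -
  obtain u v where uv: "\<And>y z. y \<in> I \<Longrightarrow> z \<in> J \<Longrightarrow> M y z = (\<Sum>k<r. u (k::nat) y * v k z)"
    using assms(1) by (auto simp: rank_le_def)
  obtain u' v' where uv': "\<And>y z. y \<in> I \<Longrightarrow> z \<in> J \<Longrightarrow> N y z = (\<Sum>k<s. u' (k::nat) y * v' k z)"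
    using assms(2) by (auto simp: rank_le_def)
  show ?thesis
  proof (rule rank_leI[where K = "{..<r} \<times> {..<s}"])
    fix y z assume "y \<in> I" "z \<in> J"
    then have "M y z * N y z = (\<Sum>k<r. \<Sum>l<s. (u k y * v k z) * (u' l y * v' l z))"
      by (simp add: uv uv' sum_product)
    also have "\<dots> = (\<Sum>k\<in>{..<r} \<times> {..<s}. (u (fst k) y * u' (snd k) y) * (v (fst k) z * v' (snd k) z))"
      by (simp add: sum.cartesian_product case_prod_unfold mult_ac)
    finally show "M y z * N y z = \<dots>" .
  qed (auto simp: card_cartesian_product)
qed

lemma rank_le_mono:
  assumes "rank_le r I J M" "r \<le> s"
  shows "rank_le s I J M"
proof -
  obtain u v where "\<And>y z. y \<in> I \<Longrightarrow> z \<in> J \<Longrightarrow> M y z = (\<Sum>k<r. u (k::nat) y * v k z)"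
    using assms(1) by (auto simp: rank_le_def)
  then show ?thesis
    using assms(2) by (intro rank_leI[where K = "{..<r}" and u = u and v = v]) auto
qed

lemma rank_le_cong:
  assumes "rank_le r I J M" "\<And>y z. y \<in> I \<Longrightarrow> z \<in> J \<Longrightarrow> M y z = N y z"
  shows "rank_le r I J N"
  using assms by (auto simp: rank_le_def)

lemma rank_le_reindex:
  assumes "rank_le r I J M" "f ` I' \<subseteq> I" "g ` J' \<subseteq> J"
  shows "rank_le r I' J' (\<lambda>y z. M (f y) (g z))"
proof -
  obtain u v where "\<And>y z. y \<in> I \<Longrightarrow> z \<in> J \<Longrightarrow> M y z = (\<Sum>k<r. u (k::nat) y * v k z)"
    using assms(1) by (auto simp: rank_le_def)
  with assms(2,3) show ?thesis
    by (intro rank_leI[where K = "{..<r}" and u = "\<lambda>k y. u k (f y)" and v = "\<lambda>k z. v k (g z)"])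
      (auto simp: image_subset_iff)
qed

lemma rank_le_sum_list:
  assumes "\<And>x. x \<in> set xs \<Longrightarrow> rank_le r I J (M x)"
  shows "rank_le (length xs * r) I J (\<lambda>y z. \<Sum>x\<leftarrow>xs. M x y z)"
proof -
  have "rank_le (card {..<length xs} * r) I J (\<lambda>y z. \<Sum>i<length xs. M (xs ! i) y z)"
    by (rule rank_le_sum) (auto intro: assms)
  then show ?thesis
    by (simp add: sum_list_sum_nth atLeast0LessThan)
qed

text \<open>Gaussian elimination, by induction on the set of equations: an equation \<open>k\<close>
  with a nonzero coefficient at \<open>y0\<close> is solved for the unknown \<open>y0\<close>, which
  leaves one equation and one unknown fewer.\<close>

lemma homogeneous_system_nontrivial_solution:
  fixes u :: "'a \<Rightarrow> 'y \<Rightarrow> 'k::field"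
  assumes "finite K" "finite I" "card K < card I"
  shows "\<exists>c. (\<exists>y\<in>I. c y \<noteq> 0) \<and> (\<forall>k\<in>K. (\<Sum>y\<in>I. c y * u k y) = 0)"
  using assms
proof (induction K arbitrary: I u rule: finite_induct)
  case empty
  then obtain y where "y \<in> I" by fastforce
  then show ?case by (intro exI[of _ "\<lambda>_. 1"]) auto
next
  case (insert k K)
  show ?case
  proof (cases "\<forall>y\<in>I. u k y = 0")
    case True
    have "card K < card I" using insert by simp
    from insert.IH[OF insert.prems(1) this, of u] obtain c
      where "\<exists>y\<in>I. c y \<noteq> 0" "\<forall>k\<in>K. (\<Sum>y\<in>I. c y * u k y) = 0" by blast
    with True show ?thesis by (intro exI[of _ c]) auto
  next
    case False
    then obtain y0 where y0: "y0 \<in> I" "u k y0 \<noteq> 0" by blast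
    let ?I = "I - {y0}"
    have "card K < card ?I" "finite ?I"
      using insert y0 by auto
    \<comment> \<open>The remaining equations, with \<open>y0\<close> eliminated by means of
      equation \<open>k\<close>.\<close>
    from insert.IH[OF this(2,1), of "\<lambda>l y. u l y - u k y / u k y0 * u l y0"] obtain c
      where c: "\<exists>y\<in>?I. c y \<noteq> 0"
        "\<And>l. l \<in> K \<Longrightarrow> (\<Sum>y\<in>?I. c y * (u l y - u k y / u k y0 * u l y0)) = 0" by blast
    \<comment> \<open>The value at \<open>y0\<close> that equation \<open>k\<close> forces.\<close>
    define c0 where "c0 = - (\<Sum>y\<in>?I. c y * u k y) / u k y0"
    define c' where "c' = c(y0 := c0)"
    have split: "(\<Sum>y\<in>I. c' y * u l y) = c0 * u l y0 + (\<Sum>y\<in>?I. c y * u l y)" for l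
      using insert.prems(1) y0 by (subst sum.remove[of _ y0]) (auto simp: c'_def)
    have "(\<Sum>y\<in>I. c' y * u l y) = 0" if "l \<in> insert k K" for l
    proof (cases "l = k")
      case True
      then show ?thesis using y0 by (simp add: split c0_def)
    next
      case False
      then have "0 = (\<Sum>y\<in>?I. c y * (u l y - u k y / u k y0 * u l y0))"
        using c(2) that by simp
      also have "\<dots> = (\<Sum>y\<in>?I. c y * u l y) - (\<Sum>y\<in>?I. c y * u k y) / u k y0 * u l y0"
        by (simp add: algebra_simps sum_subtractf sum_distrib_left sum_divide_distrib)
      finally show ?thesis by (simp add: split c0_def)
    qed
    moreover have "\<exists>y\<in>I. c' y \<noteq> 0" using c(1) by (auto simp: c'_def)
    ultimately show ?thesis by blast
  qed
qed

text \<open>With fewer than \<open>card I\<close> terms some nonzero \<open>c\<close> is orthogonal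
  to all the \<open>u k\<close>. Multiplying the decomposition by \<open>c\<close> from the left
  gives 0, but the identity gives back \<open>c\<close>.\<close>

lemma rank_le_identity:
  assumes "finite I" "rank_le r I I (\<lambda>y z. if y = z then 1 else 0 :: 'k::field)"
  shows "card I \<le> r"
proof (rule ccontr)
  assume "\<not> card I \<le> r"
  obtain u v where uv: "\<And>y z. y \<in> I \<Longrightarrow> z \<in> I \<Longrightarrow>
      (if y = z then 1 else 0 :: 'k) = (\<Sum>k<r. u (k::nat) y * v k z)"
    using assms(2) by (auto simp: rank_le_def)
  obtain c where c: "\<exists>y\<in>I. c y \<noteq> 0" "\<And>k. k < r \<Longrightarrow> (\<Sum>y\<in>I. c y * u k y) = 0"
    using homogeneous_system_nontrivial_solution[of "{..<r}" I u] assms(1) \<open>\<not> card I \<le> r\<close> by auto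
  have "c z = 0" if "z \<in> I" for z
  proof -
    have "c z = (\<Sum>y\<in>I. c y * (if y = z then 1 else 0))"
      using that assms(1) by (simp add: if_distrib cong: if_cong)
    also have "\<dots> = (\<Sum>y\<in>I. c y * (\<Sum>k<r. u k y * v k z))"
      using that by (intro sum.cong) (auto simp: uv[symmetric])
    also have "\<dots> = (\<Sum>k<r. \<Sum>y\<in>I. c y * u k y * v k z)"
      unfolding sum_distrib_left by (subst sum.swap) (simp add: mult_ac)
    also have "\<dots> = (\<Sum>k<r. (\<Sum>y\<in>I. c y * u k y) * v k z)"
      by (simp add: sum_distrib_right)
    also have "\<dots> = 0" by (simp add: c(2))
    finally show ?thesis .
  qed
  with c(1) show False by blast
qed

section \<open>Coefficients of ordered set-multilinear programs\<close>

text \<open>Variable \<open>i * n + b\<close> stands for the letter \<open>b\<close> at position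
  \<open>i\<close>. The set \<open>D\<close> of positions is a parameter because the first layers of
  a program produce words on a part of the positions.\<close>

definition word_monom :: "nat \<Rightarrow> nat set \<Rightarrow> (nat \<Rightarrow> nat) \<Rightarrow> nat \<Rightarrow>\<^sub>0 nat" where
  "word_monom n D s = (\<Sum>i\<in>D. Poly_Mapping.single (i * n + s i) 1)"

definition var_blocks :: "nat \<Rightarrow> nat \<Rightarrow> nat set list" where
  "var_blocks n d = map (\<lambda>i. {i * n..<i * n + n}) [0..<d]"

lemma length_var_blocks [simp]: "length (var_blocks n d) = d"
  by (simp add: var_blocks_def)

lemma nth_var_blocks [simp]: "i < d \<Longrightarrow> var_blocks n d ! i = {i * n..<i * n + n}"
  by (simp add: var_blocks_def)

lemma block_index_eq_iff:
  fixes a b i j n :: nat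
  assumes "a < n" "b < n"
  shows "i * n + a = j * n + b \<longleftrightarrow> i = j \<and> a = b"
proof
  assume eq: "i * n + a = j * n + b"
  have "i = (i * n + a) div n" using assms by simp
  also have "\<dots> = j" unfolding eq using assms by simp
  finally show "i = j \<and> a = b" using eq by simp
qed simp

lemma is_var_partition_var_blocks: "is_var_partition n (var_blocks n d)"
proof -
  have "{i * n..<i * n + n} \<inter> {j * n..<j * n + n} = {}" if "i \<noteq> j" for i j
  proof (rule ccontr)
    assume "\<not> ?thesis"
    then obtain v where "v \<in> {i * n..<i * n + n} \<inter> {j * n..<j * n + n}" by blast
    then have "i * n + (v - i * n) = j * n + (v - j * n)" "v - i * n < n" "v - j * n < n"
      by auto
    then show False using block_index_eq_iff that by blast
  qed
  then show ?thesis by (auto simp: is_var_partition_def)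
qed

lemma lookup_word_monom:
  assumes "finite D" "i \<in> D" "b < n" "\<And>i. i \<in> D \<Longrightarrow> s i < n"
  shows "Poly_Mapping.lookup (word_monom n D s) (i * n + b) = (if s i = b then 1 else 0)"
proof -
  have "Poly_Mapping.lookup (word_monom n D s) (i * n + b)
      = (\<Sum>j\<in>D. if j = i then (if s i = b then 1 else 0) else 0)"
    unfolding word_monom_def lookup_sum lookup_single when_def
    using assms by (intro sum.cong) (auto simp: block_index_eq_iff)
  then show ?thesis using assms by simp
qed

lemma word_monom_eq_iff:
  assumes "finite D" "\<And>i. i \<in> D \<Longrightarrow> s i < n" "\<And>i. i \<in> D \<Longrightarrow> s' i < n"
  shows "word_monom n D s = word_monom n D s' \<longleftrightarrow> (\<forall>i\<in>D. s i = s' i)"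
proof
  assume eq: "word_monom n D s = word_monom n D s'"
  show "\<forall>i\<in>D. s i = s' i"
  proof
    fix i assume i: "i \<in> D"
    have "(if s' i = s i then 1 else 0 :: nat) = 1"
      using lookup_word_monom[where s = s, OF assms(1) i assms(2)[OF i] assms(2)]
        lookup_word_monom[where s = s', OF assms(1) i assms(2)[OF i] assms(3)] eq
      by simp
    then show "s i = s' i" by (simp split: if_splits)
  qed
qed (simp add: word_monom_def)

lemma word_monom_cong:
  "(\<And>i. i \<in> D \<Longrightarrow> s i = s' i) \<Longrightarrow> word_monom n D s = word_monom n D s'"
  by (simp add: word_monom_def)

section \<open>Coefficients as path sums\<close>

text \<open>The coefficient of the word \<open>s\<close> in the sum over all paths with
  \<open>k\<close> edges from node \<open>i\<close> of layer \<open>l\<close> to node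
  \<open>j\<close>. Here \<open>\<alpha> (Suc l) i j b\<close> is the coefficient of the letter
  \<open>b\<close> in an edge label, and the edges leaving layer \<open>l\<close> read position
  \<open>\<sigma> l\<close>.\<close>

fun path_coeff :: "(nat \<Rightarrow> nat) \<Rightarrow> (nat \<Rightarrow> nat) \<Rightarrow> (nat \<Rightarrow> nat \<Rightarrow> nat \<Rightarrow> nat \<Rightarrow> 'k::comm_ring_1) \<Rightarrow>
    nat \<Rightarrow> nat \<Rightarrow> nat \<Rightarrow> nat \<Rightarrow> (nat \<Rightarrow> nat) \<Rightarrow> 'k" where
  "path_coeff w \<sigma> \<alpha> l i 0 j s = (if i = j then 1 else 0)"
| "path_coeff w \<sigma> \<alpha> l i (Suc k) j s =
     (\<Sum>i'<w (l + k). path_coeff w \<sigma> \<alpha> l i k i' s * \<alpha> (Suc (l + k)) i' j (s (\<sigma> (l + k))))"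

lemma path_coeff_cong:
  assumes "\<And>p. p \<in> \<sigma> ` {l..<l + k} \<Longrightarrow> s p = s' p"
  shows "path_coeff w \<sigma> \<alpha> l i k j s = path_coeff w \<sigma> \<alpha> l i k j s'"
  using assms
proof (induction k arbitrary: j)
  case (Suc k)
  have "path_coeff w \<sigma> \<alpha> l i k i' s = path_coeff w \<sigma> \<alpha> l i k i' s'" for i'
    using Suc.prems by (intro Suc.IH) auto
  moreover have "s (\<sigma> (l + k)) = s' (\<sigma> (l + k))" using Suc.prems by auto
  ultimately show ?case by simp
qed simp

text \<open>Every path is split at its node in layer \<open>l + k1\<close>, as in a product of
  matrices. For \<open>k2 = 0\<close> the sum collapses to \<open>i' = j\<close>, which requires
  \<open>j\<close> to be a node of that layer.\<close>

lemma path_coeff_add: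
  assumes "j < w (l + k1 + k2)"
  shows "path_coeff w \<sigma> \<alpha> l i (k1 + k2) j s =
    (\<Sum>i'<w (l + k1). path_coeff w \<sigma> \<alpha> l i k1 i' s * path_coeff w \<sigma> \<alpha> (l + k1) i' k2 j s)"
  using assms
proof (induction k2 arbitrary: j)
  case 0
  then show ?case by (simp add: if_distrib cong: if_cong)
next
  case (Suc k2)
  let ?e = "\<lambda>i''. \<alpha> (Suc (l + k1 + k2)) i'' j (s (\<sigma> (l + k1 + k2)))"
  have "path_coeff w \<sigma> \<alpha> l i (k1 + Suc k2) j s =
    (\<Sum>i''<w (l + k1 + k2). path_coeff w \<sigma> \<alpha> l i (k1 + k2) i'' s * ?e i'')"
    by (simp add: add.assoc)
  also have "\<dots> = (\<Sum>i''<w (l + k1 + k2). \<Sum>i'<w (l + k1). path_coeff w \<sigma> \<alpha> l i k1 i' s *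
      (path_coeff w \<sigma> \<alpha> (l + k1) i' k2 i'' s * ?e i''))"
    by (intro sum.cong refl) (simp add: Suc.IH sum_distrib_right mult.assoc)
  also have "\<dots> = (\<Sum>i'<w (l + k1). path_coeff w \<sigma> \<alpha> l i k1 i' s *
      path_coeff w \<sigma> \<alpha> (l + k1) i' (Suc k2) j s)"
    by (subst sum.swap) (simp add: sum_distrib_left add.assoc)
  finally show ?case .
qed

lemma linear_form_block:
  assumes "is_linear_form_in {p * n..<p * n + n} q"
  shows "\<exists>a. q = (\<Sum>b<n. Poly_Mapping.single (Poly_Mapping.single (p * n + b) 1) (a b))"
proof -
  obtain a where "q = (\<Sum>v\<in>{p * n..<p * n + n}. Const (a v) * Var v)"
    using assms by (auto simp: is_linear_form_in_def)
  also have "\<dots> = (\<Sum>v\<in>{p * n..<p * n + n}. Poly_Mapping.single (Poly_Mapping.single v 1) (a v))"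
    by (simp add: Const_def Var_def mult_single)
  also have "\<dots> = (\<Sum>b<n. Poly_Mapping.single (Poly_Mapping.single (p * n + b) 1) (a (p * n + b)))"
    by (rule sum.reindex_bij_witness[of _ "\<lambda>b. p * n + b" "\<lambda>v. v - p * n"]) auto
  finally show ?thesis by (intro exI[of _ "\<lambda>b. a (p * n + b)"])
qed

lemma single_sum: "Poly_Mapping.single k (sum f S) = (\<Sum>x\<in>S. Poly_Mapping.single k (f x))"
  by (induction S rule: infinite_finite_induct) (auto simp: single_add)

lemma sum_PiE_insert:
  assumes "x \<notin> S"
  shows "(\<Sum>s\<in>Pi\<^sub>E (insert x S) (\<lambda>_. T). f s) = (\<Sum>s\<in>Pi\<^sub>E S (\<lambda>_. T). \<Sum>b\<in>T. f (s(x := b)))"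
proof -
  have "(\<Sum>s\<in>Pi\<^sub>E (insert x S) (\<lambda>_. T). f s) = (\<Sum>(b, s)\<in>T \<times> Pi\<^sub>E S (\<lambda>_. T). f (s(x := b)))"
    unfolding PiE_insert_eq
    by (subst sum.reindex[OF inj_combinator[OF assms]]) (simp add: case_prod_unfold)
  also have "\<dots> = (\<Sum>b\<in>T. \<Sum>s\<in>Pi\<^sub>E S (\<lambda>_. T). f (s(x := b)))"
    by (simp add: sum.cartesian_product)
  finally show ?thesis by (subst (asm) sum.swap)
qed

text \<open>The first \<open>l\<close> layers read the positions \<open>\<sigma> 0\<close>, ...,
  \<open>\<sigma> (l - 1)\<close>, each exactly once. The monomials that occur are those of the
  words on these positions, and a new layer extends every word by one letter.\<close>

lemma abp_val_ordered:
  assumes "\<sigma> permutes {..<d}"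
    and label: "\<And>l i j. l < d \<Longrightarrow> i < w l \<Longrightarrow> j < w (Suc l) \<Longrightarrow> L (Suc l) i j =
      (\<Sum>b<n. Poly_Mapping.single (Poly_Mapping.single (\<sigma> l * n + b) 1) (\<alpha> (Suc l) i j b))"
    and "l \<le> d" "j < w l" "w 0 = 1"
  shows "abp_val w L l j = (\<Sum>s\<in>Pi\<^sub>E (\<sigma> ` {..<l}) (\<lambda>_. {..<n}).
    Poly_Mapping.single (word_monom n (\<sigma> ` {..<l}) s) (path_coeff w \<sigma> \<alpha> 0 0 l j s))"
  using assms(3,4)
proof (induction l arbitrary: j)
  case 0
  then show ?case using assms(5) by (simp add: word_monom_def)
next
  case (Suc l)
  let ?S = "\<sigma> ` {..<l}" and ?x = "\<sigma> l"
  let ?P = "Pi\<^sub>E ?S (\<lambda>_. {..<n})"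
  have x: "?x \<notin> ?S"
    using permutes_inj[OF assms(1)] by (auto dest: injD)
  have monom: "word_monom n (insert ?x ?S) (s(?x := b))
      = word_monom n ?S s + Poly_Mapping.single (?x * n + b) 1" for s b
  proof -
    have "word_monom n ?S (s(?x := b)) = word_monom n ?S s"
      by (rule word_monom_cong) (use x in \<open>metis fun_upd_other\<close>)
    then show ?thesis using x by (simp add: word_monom_def add.commute)
  qed
  have coeff: "path_coeff w \<sigma> \<alpha> 0 0 l i (s(?x := b)) = path_coeff w \<sigma> \<alpha> 0 0 l i s" for i s b
    by (rule path_coeff_cong) (use x in \<open>metis add_0 atLeast0LessThan fun_upd_other\<close>)
  have "abp_val w L (Suc l) j = (\<Sum>i<w l. (\<Sum>s\<in>?P.
      Poly_Mapping.single (word_monom n ?S s) (path_coeff w \<sigma> \<alpha> 0 0 l i s)) *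
      (\<Sum>b<n. Poly_Mapping.single (Poly_Mapping.single (?x * n + b) 1) (\<alpha> (Suc l) i j b)))"
    using Suc by (simp add: label)
  also have "\<dots> = (\<Sum>i<w l. \<Sum>s\<in>?P. \<Sum>b<n.
      Poly_Mapping.single (word_monom n ?S s + Poly_Mapping.single (?x * n + b) 1)
        (path_coeff w \<sigma> \<alpha> 0 0 l i s * \<alpha> (Suc l) i j b))"
    by (simp add: sum_product mult_single)
  also have "\<dots> = (\<Sum>s\<in>?P. \<Sum>i<w l. \<Sum>b<n.
      Poly_Mapping.single (word_monom n ?S s + Poly_Mapping.single (?x * n + b) 1)
        (path_coeff w \<sigma> \<alpha> 0 0 l i s * \<alpha> (Suc l) i j b))"
    by (rule sum.swap)
  also have "\<dots> = (\<Sum>s\<in>?P. \<Sum>b<n. Poly_Mapping.single (word_monom n (insert ?x ?S) (s(?x := b)))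
        (path_coeff w \<sigma> \<alpha> 0 0 (Suc l) j (s(?x := b))))"
    by (rule sum.cong[OF refl], subst sum.swap) (simp add: monom coeff single_sum)
  also have "\<dots> = (\<Sum>s\<in>Pi\<^sub>E (insert ?x ?S) (\<lambda>_. {..<n}).
      Poly_Mapping.single (word_monom n (insert ?x ?S) s) (path_coeff w \<sigma> \<alpha> 0 0 (Suc l) j s))"
    by (rule sum_PiE_insert[OF x, symmetric])
  finally show ?case by (simp add: lessThan_Suc)
qed

lemma sm_abp_coeff:
  fixes L :: "nat \<Rightarrow> nat \<Rightarrow> nat \<Rightarrow> 'k::comm_ring_1 mpoly"
  assumes "sm_abp (var_blocks n d) \<sigma> (m, w, L)"
  shows "\<exists>\<alpha>. \<forall>s. (\<forall>i<d. s i < n) \<longrightarrow>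
    Poly_Mapping.lookup (abp_poly (m, w, L)) (word_monom n {..<d} s) = path_coeff w \<sigma> \<alpha> 0 0 d 0 s"
proof -
  have m: "m = d" and \<sigma>: "\<sigma> permutes {..<d}" and w: "w 0 = 1" "w d = 1"
    and labels: "\<forall>l\<in>{1..d}. \<forall>i<w (l - 1). \<forall>j<w l.
      is_linear_form_in (var_blocks n d ! \<sigma> (l - 1)) (L l i j)"
    using assms by (auto simp: sm_abp_def abp_wf_def)
  have form: "is_linear_form_in (var_blocks n d ! \<sigma> l) (L (Suc l) i j)"
    if "l < d" "i < w l" "j < w (Suc l)" for l i j
    using labels[rule_format, of "Suc l" i j] that by simp
  have \<sigma>_less: "\<sigma> l < d" if "l < d" for l
    using permutes_in_image[OF \<sigma>, of l] that by simp
  have \<sigma>_image: "\<sigma> ` {..<d} = {..<d}" using \<sigma> by (rule permutes_image)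
  have "\<forall>l i j. \<exists>a. l < d \<longrightarrow> i < w l \<longrightarrow> j < w (Suc l) \<longrightarrow> L (Suc l) i j =
      (\<Sum>b<n. Poly_Mapping.single (Poly_Mapping.single (\<sigma> l * n + b) 1) (a b))"
    using form linear_form_block \<sigma>_less by (metis nth_var_blocks)
  then obtain a where "\<And>l i j. l < d \<Longrightarrow> i < w l \<Longrightarrow> j < w (Suc l) \<Longrightarrow> L (Suc l) i j =
      (\<Sum>b<n. Poly_Mapping.single (Poly_Mapping.single (\<sigma> l * n + b) 1) (a l i j b))"
    by metis
  \<comment> \<open>Edge labels are numbered from layer 1 and \<open>a\<close> from layer 0, hence
    the shift \<open>l - 1\<close>.\<close>
  then have "abp_val w L d 0 = (\<Sum>s\<in>Pi\<^sub>E (\<sigma> ` {..<d}) (\<lambda>_. {..<n}).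
      Poly_Mapping.single (word_monom n (\<sigma> ` {..<d}) s)
        (path_coeff w \<sigma> (\<lambda>l. a (l - 1)) 0 0 d 0 s))"
    using w by (intro abp_val_ordered[OF \<sigma>]) auto
  then have poly: "abp_poly (m, w, L) = (\<Sum>s\<in>Pi\<^sub>E {..<d} (\<lambda>_. {..<n}).
      Poly_Mapping.single (word_monom n {..<d} s) (path_coeff w \<sigma> (\<lambda>l. a (l - 1)) 0 0 d 0 s))"
    by (simp add: abp_poly_def m \<sigma>_image)
  show ?thesis
  proof (intro exI[of _ "\<lambda>l. a (l - 1)"] allI impI)
    fix s assume s: "\<forall>i<d. s i < n"
    \<comment> \<open>Functions in the product are \<open>undefined\<close> outside
      \<open>{..<d}\<close>, so among them exactly the restriction of \<open>s\<close> has the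
      monomial of \<open>s\<close>.\<close>
    let ?r = "restrict s {..<d}"
    have r: "?r \<in> Pi\<^sub>E {..<d} (\<lambda>_. {..<n})" using s by auto
    have "word_monom n {..<d} s' = word_monom n {..<d} s \<longleftrightarrow> s' = ?r"
      if s': "s' \<in> Pi\<^sub>E {..<d} (\<lambda>_. {..<n})" for s'
    proof -
      have "word_monom n {..<d} s' = word_monom n {..<d} s \<longleftrightarrow> (\<forall>i\<in>{..<d}. s' i = ?r i)"
        using s s' by (subst word_monom_eq_iff) (auto simp: PiE_iff)
      then show ?thesis using PiE_ext[OF s' r] by auto
    qed
    then have "Poly_Mapping.lookup (abp_poly (m, w, L)) (word_monom n {..<d} s)
        = path_coeff w \<sigma> (\<lambda>l. a (l - 1)) 0 0 d 0 ?r"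
      using r unfolding poly lookup_sum lookup_single when_def
      by (simp add: finite_PiE cong: sum.cong if_cong)
    also have "\<dots> = path_coeff w \<sigma> (\<lambda>l. a (l - 1)) 0 0 d 0 s"
      using \<sigma>_less by (intro path_coeff_cong) auto
    finally show "Poly_Mapping.lookup (abp_poly (m, w, L)) (word_monom n {..<d} s)
        = path_coeff w \<sigma> (\<lambda>l. a (l - 1)) 0 0 d 0 s" .
  qed
qed

section \<open>The rank of a program cut into blocks\<close>

text \<open>Letters \<open>y\<close> on \<open>U\<close>, \<open>z\<close> on \<open>V\<close> and
  the skipped letter 0 elsewhere. The coefficients of these words form a matrix with rows
  \<open>y\<close> and columns \<open>z\<close>.\<close>

definition combine :: "nat set \<Rightarrow> nat set \<Rightarrow> (nat \<Rightarrow> nat) \<Rightarrow> (nat \<Rightarrow> nat) \<Rightarrow> nat \<Rightarrow> nat" where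
  "combine U V y z i = (if i \<in> U then y i else if i \<in> V then z i else 0)"

text \<open>A function of the letters in \<open>B\<close> sees \<open>y\<close> only through its
  restriction to \<open>U \<inter> B\<close>, so its matrix has at most
  \<open>card T ^ card (U \<inter> B)\<close> distinct rows. The same count for columns uses
  \<open>V \<inter> B\<close>, and the smaller bound is taken.\<close>

lemma rank_le_block:
  fixes g :: "(nat \<Rightarrow> nat) \<Rightarrow> 'k::field"
  assumes local: "\<And>s s'. (\<And>i. i \<in> B \<Longrightarrow> s i = s' i) \<Longrightarrow> g s = g s'"
    and "finite U" "finite V" "U \<inter> V = {}" "finite T" "T \<noteq> {}"
  shows "rank_le (card T ^ min (card (U \<inter> B)) (card (V \<inter> B)))
    (Pi\<^sub>E U (\<lambda>_. T)) (Pi\<^sub>E V (\<lambda>_. T)) (\<lambda>y z. g (combine U V y z))"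
proof -
  have restrict: "restrict y (D \<inter> B) \<in> Pi\<^sub>E (D \<inter> B) (\<lambda>_. T)" if "y \<in> Pi\<^sub>E D (\<lambda>_. T)" for y D
    using that by (auto simp: PiE_iff)
  have delta: "(\<Sum>\<tau>\<in>Pi\<^sub>E (D \<inter> B) (\<lambda>_. T). (if restrict y (D \<inter> B) = \<tau> then 1 else 0) * h \<tau>)
      = h (restrict y (D \<inter> B))"
    if "y \<in> Pi\<^sub>E D (\<lambda>_. T)" "finite D" for y D and h :: "(nat \<Rightarrow> nat) \<Rightarrow> 'k"
  proof -
    have "(\<Sum>\<tau>\<in>Pi\<^sub>E (D \<inter> B) (\<lambda>_. T). (if restrict y (D \<inter> B) = \<tau> then 1 else 0) * h \<tau>)
        = (\<Sum>\<tau>\<in>Pi\<^sub>E (D \<inter> B) (\<lambda>_. T). if restrict y (D \<inter> B) = \<tau> then h \<tau> else 0)"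
      by (intro sum.cong) auto
    also have "\<dots> = h (restrict y (D \<inter> B))"
      using restrict[OF that(1)] that(2) assms(5) by (subst sum.delta') (auto intro!: finite_PiE)
    finally show ?thesis .
  qed
  have U: "rank_le (card T ^ card (U \<inter> B))
      (Pi\<^sub>E U (\<lambda>_. T)) (Pi\<^sub>E V (\<lambda>_. T)) (\<lambda>y z. g (combine U V y z))"
  proof (rule rank_leI[where K = "Pi\<^sub>E (U \<inter> B) (\<lambda>_. T)"
        and u = "\<lambda>\<tau> y. if restrict y (U \<inter> B) = \<tau> then 1 else 0"
        and v = "\<lambda>\<tau> z. g (combine U V \<tau> z)"])
    fix y z assume "y \<in> Pi\<^sub>E U (\<lambda>_. T)"
    then show "g (combine U V y z) = (\<Sum>\<tau>\<in>Pi\<^sub>E (U \<inter> B) (\<lambda>_. T).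
        (if restrict y (U \<inter> B) = \<tau> then 1 else 0) * g (combine U V \<tau> z))"
      using assms(2) by (subst delta) (auto simp: combine_def intro!: local)
  qed (use assms(2-) in \<open>auto simp: finite_PiE card_funcsetE\<close>)
  have V: "rank_le (card T ^ card (V \<inter> B))
      (Pi\<^sub>E U (\<lambda>_. T)) (Pi\<^sub>E V (\<lambda>_. T)) (\<lambda>y z. g (combine U V y z))"
  proof (rule rank_leI[where K = "Pi\<^sub>E (V \<inter> B) (\<lambda>_. T)"
        and v = "\<lambda>\<tau> z. if restrict z (V \<inter> B) = \<tau> then 1 else 0"
        and u = "\<lambda>\<tau> y. g (combine U V y \<tau>)"])
    fix y z assume "z \<in> Pi\<^sub>E V (\<lambda>_. T)"
    then show "g (combine U V y z) = (\<Sum>\<tau>\<in>Pi\<^sub>E (V \<inter> B) (\<lambda>_. T).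
        g (combine U V y \<tau>) * (if restrict z (V \<inter> B) = \<tau> then 1 else 0))"
      using assms(3) by (subst mult.commute, subst delta) (auto simp: combine_def intro!: local)
  qed (use assms(2-) in \<open>auto simp: finite_PiE card_funcsetE\<close>)
  show ?thesis using U V by (simp add: min_def)
qed

text \<open>Cutting at layer \<open>bnd t\<close> writes the matrix as a sum, over the nodes of that
  layer, of entrywise products of a part before the cut and a part after it. Each block therefore
  multiplies the rank by at most \<open>W\<close> and by the bound for this block.\<close>

lemma rank_le_path_coeff:
  fixes \<alpha> :: "nat \<Rightarrow> nat \<Rightarrow> nat \<Rightarrow> nat \<Rightarrow> 'k::field" and bnd :: "nat \<Rightarrow> nat"
  assumes bnd: "bnd 0 = 0" "mono bnd" "\<And>t. t < q \<Longrightarrow> w (bnd t) \<le> W"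
    and UV: "finite U" "finite V" "U \<inter> V = {}" "finite T" "T \<noteq> {}"
    and "t \<le> q" "j < w (bnd t)"
  shows "rank_le (W ^ t * card T ^ (\<Sum>t'<t. min (card (U \<inter> \<sigma> ` {bnd t'..<bnd (Suc t')}))
      (card (V \<inter> \<sigma> ` {bnd t'..<bnd (Suc t')}))))
    (Pi\<^sub>E U (\<lambda>_. T)) (Pi\<^sub>E V (\<lambda>_. T)) (\<lambda>y z. path_coeff w \<sigma> \<alpha> 0 0 (bnd t) j (combine U V y z))"
  using assms(9,10)
proof (induction t arbitrary: j)
  case 0
  show ?case
    by (rule rank_leI[where K = "{0::nat}" and u = "\<lambda>_ _. if 0 = j then 1 else 0" and v = "\<lambda>_ _. 1"])
      (auto simp: bnd(1))
next
  case (Suc t)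
  let ?min = "\<lambda>t. min (card (U \<inter> \<sigma> ` {bnd t..<bnd (Suc t)})) (card (V \<inter> \<sigma> ` {bnd t..<bnd (Suc t)}))"
  let ?R = "W ^ t * card T ^ (\<Sum>t'<t. ?min t')"
  have le: "bnd t \<le> bnd (Suc t)" using bnd(2) by (simp add: monoD)
  have "rank_le (card {..<w (bnd t)} * (?R * card T ^ ?min t))
    (Pi\<^sub>E U (\<lambda>_. T)) (Pi\<^sub>E V (\<lambda>_. T)) (\<lambda>y z. \<Sum>i<w (bnd t).
      path_coeff w \<sigma> \<alpha> 0 0 (bnd t) i (combine U V y z) *
      path_coeff w \<sigma> \<alpha> (bnd t) i (bnd (Suc t) - bnd t) j (combine U V y z))"
    (is "rank_le ?r ?I ?J ?M")
  proof (rule rank_le_sum[OF _ rank_le_mult])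
    fix i assume "i \<in> {..<w (bnd t)}"
    then show "rank_le ?R ?I ?J (\<lambda>y z. path_coeff w \<sigma> \<alpha> 0 0 (bnd t) i (combine U V y z))"
      using Suc.prems by (intro Suc.IH) auto
    show "rank_le (card T ^ ?min t) ?I ?J
      (\<lambda>y z. path_coeff w \<sigma> \<alpha> (bnd t) i (bnd (Suc t) - bnd t) j (combine U V y z))"
      using UV le by (intro rank_le_block path_coeff_cong) auto
  qed simp
  moreover have "?r \<le> W ^ Suc t * card T ^ (\<Sum>t'<Suc t. ?min t')"
    using bnd(3)[of t] Suc.prems by (simp add: power_add)
  moreover have "?M = (\<lambda>y z. path_coeff w \<sigma> \<alpha> 0 0 (bnd (Suc t)) j (combine U V y z))"
    using path_coeff_add[of j w 0 "bnd t" "bnd (Suc t) - bnd t" \<sigma> \<alpha> 0] le Suc.prems by simp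
  ultimately show ?case using rank_le_mono[of ?r ?I ?J ?M] by simp
qed

lemma abp_width_pos: "abp_wf A \<Longrightarrow> 1 \<le> abp_width A"
  by (auto simp: abp_wf_def abp_width_def intro!: Max_ge image_eqI[of _ _ 0] split: prod.splits)

text \<open>All cut layers have at most \<open>W\<close> nodes, and \<open>U\<close> and
  \<open>V\<close> carry only the \<open>n - 1\<close> nonzero letters, so
  \<open>rank_le_path_coeff\<close> applies to the whole program.\<close>

lemma rank_le_sm_abp:
  fixes A :: "'k::field abp"
  assumes A: "sm_abp (var_blocks n d) \<sigma> A" "abp_width A \<le> W"
    and bnd: "bnd 0 = 0" "mono bnd" "bnd q = d"
    and UV: "U \<subseteq> {..<d}" "V \<subseteq> {..<d}" "U \<inter> V = {}" "n \<ge> 2"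
  shows "rank_le (W ^ q * (n - 1) ^ (\<Sum>t<q. min (card (U \<inter> \<sigma> ` {bnd t..<bnd (Suc t)}))
      (card (V \<inter> \<sigma> ` {bnd t..<bnd (Suc t)}))))
    (Pi\<^sub>E U (\<lambda>_. {1..<n})) (Pi\<^sub>E V (\<lambda>_. {1..<n}))
    (\<lambda>y z. Poly_Mapping.lookup (abp_poly A) (word_monom n {..<d} (combine U V y z)))"
proof -
  obtain m w L where A_eq: "A = (m, w, L)" by (cases A) auto
  have m: "m = d" and w: "w d = 1" using A by (auto simp: A_eq sm_abp_def abp_wf_def)
  have width: "w l \<le> W" if "l \<le> d" for l
    using that A(2) by (auto simp: A_eq abp_width_def m)
  obtain \<alpha> where \<alpha>: "\<And>s. (\<forall>i<d. s i < n) \<Longrightarrow>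
      Poly_Mapping.lookup (abp_poly A) (word_monom n {..<d} s) = path_coeff w \<sigma> \<alpha> 0 0 d 0 s"
    using sm_abp_coeff A(1) unfolding A_eq by blast
  have "finite U" "finite V" using UV by (auto intro: finite_subset)
  have "rank_le (W ^ q * card {1..<n} ^ (\<Sum>t<q. min (card (U \<inter> \<sigma> ` {bnd t..<bnd (Suc t)}))
      (card (V \<inter> \<sigma> ` {bnd t..<bnd (Suc t)}))))
    (Pi\<^sub>E U (\<lambda>_. {1..<n})) (Pi\<^sub>E V (\<lambda>_. {1..<n}))
    (\<lambda>y z. path_coeff w \<sigma> \<alpha> 0 0 (bnd q) 0 (combine U V y z))"
  proof (rule rank_le_path_coeff[OF bnd(1,2)])
    fix t assume "t < q"
    then have "bnd t \<le> d" using bnd(2,3) by (metis less_imp_le monoD)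
    then show "w (bnd t) \<le> W" by (rule width)
  qed (use UV w bnd \<open>finite U\<close> \<open>finite V\<close> in auto)
  moreover have "path_coeff w \<sigma> \<alpha> 0 0 (bnd q) 0 (combine U V y z)
      = Poly_Mapping.lookup (abp_poly A) (word_monom n {..<d} (combine U V y z))"
    if "y \<in> Pi\<^sub>E U (\<lambda>_. {1..<n})" "z \<in> Pi\<^sub>E V (\<lambda>_. {1..<n})" for y z
    using that UV(4) by (subst \<alpha>) (auto simp: combine_def PiE_iff bnd(3))
  ultimately show ?thesis unfolding card_atLeastLessThan by (rule rank_le_cong)
qed

section \<open>The hard polynomial\<close>

lemma is_linear_poly_Var: "is_linear_poly (Var v)"
  unfolding is_linear_poly_def
  by (intro exI[of _ 0] exI[of _ "\<lambda>_. 1"] exI[of _ "{v}"]) (simp add: Const_def)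

lemma is_linear_poly_0: "is_linear_poly 0"
  unfolding is_linear_poly_def
  by (intro exI[of _ 0] exI[of _ "\<lambda>_. 1"] exI[of _ "{}"]) (simp add: Const_def)

text \<open>Backward evaluation: \<open>Q l k\<close> is the polynomial computed from state \<open>k\<close> of layer \<open>l\<close> to the end.\<close>

lemma abp_of_transition_system:
  fixes D :: "nat \<Rightarrow> nat \<Rightarrow> nat \<Rightarrow> 'k::comm_ring_1 mpoly"
  assumes "d \<ge> 1" "k0 < S" "kf < S"
    and linear: "\<And>l k k'. is_linear_poly (D l k k')"
    and step: "\<And>l k. l < d \<Longrightarrow> k < S \<Longrightarrow> Q l k = (\<Sum>k'<S. D l k k' * Q (Suc l) k')"
    and final: "\<And>k. k < S \<Longrightarrow> Q d k = (if k = kf then 1 else 0)"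
  shows "\<exists>A. abp_wf A \<and> abp_poly A = Q 0 k0 \<and> abp_size A \<le> (d + 1) * S"
proof -
  \<comment> \<open>Start and end layer consist of the single states \<open>k0\<close> and
    \<open>kf\<close>; every inner layer has all \<open>S\<close> states. The function
    \<open>node\<close> translates node numbers into states.\<close>
  define w where "w l = (if l = 0 \<or> l = d then 1 else S)" for l
  define node where "node l i = (if l = 0 then k0 else if l = d then kf else i)" for l i :: nat
  define L where "L l i j = D (l - 1) (node (l - 1) i) (node l j)" for l i j
  have node_less: "node l i < S" if "i < w l" for l i
    using that assms(2,3) by (auto simp: node_def w_def split: if_splits)
  \<comment> \<open>In the last layer \<open>Q d\<close> vanishes at all states but
    \<open>kf\<close>, so nothing is lost by keeping this state alone.\<close>
  have collapse: "(\<Sum>j<w (Suc l). D l k (node (Suc l) j) * Q (Suc l) (node (Suc l) j))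
      = (\<Sum>k'<S. D l k k' * Q (Suc l) k')" if "l < d" for l k
  proof (cases "Suc l = d")
    case True
    have "(\<Sum>k'<S. D l k k' * Q d k') = (\<Sum>k'<S. if k' = kf then D l k kf else 0)"
      by (intro sum.cong) (auto simp: final)
    then show ?thesis
      using assms(1,3) True by (auto simp: w_def node_def final)
  qed (use that in \<open>simp add: w_def node_def\<close>)
  \<comment> \<open>The forward values, weighted by the backward polynomials, have the same sum in
    every layer. Layer 0 gives \<open>Q 0 k0\<close> and layer \<open>d\<close> gives the polynomial
    of the program.\<close>
  have inv: "(\<Sum>i<w l. abp_val w L l i * Q l (node l i)) = Q 0 k0" if "l \<le> d" for l
    using that
  proof (induction l)
    case 0
    then show ?case by (simp add: w_def node_def)
  next
    case (Suc l)
    have "(\<Sum>j<w (Suc l). abp_val w L (Suc l) j * Q (Suc l) (node (Suc l) j))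
      = (\<Sum>i<w l. abp_val w L l i *
          (\<Sum>j<w (Suc l). D l (node l i) (node (Suc l) j) * Q (Suc l) (node (Suc l) j)))"
      by (simp add: sum_distrib_right sum_distrib_left L_def mult.assoc) (rule sum.swap)
    also have "\<dots> = (\<Sum>i<w l. abp_val w L l i * Q l (node l i))"
      using Suc.prems by (intro sum.cong refl) (simp add: collapse step node_less)
    finally show ?case using Suc by simp
  qed
  have "abp_poly (d, w, L) = Q 0 k0"
    using inv[of d] assms(1,3) by (simp add: abp_poly_def w_def node_def final)
  moreover have "abp_wf (d, w, L)"
    using assms(1) linear by (auto simp: abp_wf_def w_def L_def)
  moreover have "abp_size (d, w, L) \<le> (d + 1) * S"
  proof -
    have "abp_size (d, w, L) \<le> of_nat (card {..d}) * S"
      unfolding abp_size_def prod.case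
      by (intro sum_bounded_above) (use assms(2) in \<open>auto simp: w_def\<close>)
    then show ?thesis by simp
  qed
  ultimately show ?thesis by blast
qed

section \<open>Words and the recursions of the hard polynomial\<close>

definition words :: "nat \<Rightarrow> nat \<Rightarrow> nat list set" where
  "words n k = {xs. set xs \<subseteq> {..<n} \<and> length xs = k}"

lemma finite_words [simp]: "finite (words n k)"
  unfolding words_def by (rule finite_lists_length_eq) simp

lemma words_0 [simp]: "words n 0 = {[]}"
  by (auto simp: words_def)

lemma sum_words_Suc:
  "(\<Sum>xs\<in>words n (Suc k). f xs) = (\<Sum>b<n. \<Sum>xs\<in>words n k. f (b # xs))"
proof -
  have "(\<Sum>xs\<in>words n (Suc k). f xs) = (\<Sum>(b, xs)\<in>{..<n} \<times> words n k. f (b # xs))"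
    by (rule sum.reindex_bij_witness[of _ "\<lambda>(b, xs). b # xs" "\<lambda>xs. (hd xs, tl xs)"])
      (auto simp: words_def length_Suc_conv)
  then show ?thesis by (simp add: sum.cartesian_product)
qed

lemma sum_words_add:
  "(\<Sum>xs\<in>words n (k + l). f xs) = (\<Sum>xs\<in>words n k. \<Sum>ys\<in>words n l. f (xs @ ys))"
proof -
  have "(\<Sum>xs\<in>words n (k + l). f xs) = (\<Sum>(xs, ys)\<in>words n k \<times> words n l. f (xs @ ys))"
    by (rule sum.reindex_bij_witness[of _ "\<lambda>(xs, ys). xs @ ys" "\<lambda>xs. (take k xs, drop k xs)"])
      (auto simp: words_def dest: in_set_takeD in_set_dropD)
  then show ?thesis by (simp add: sum.cartesian_product)
qed

fun word_poly :: "nat \<Rightarrow> nat \<Rightarrow> nat list \<Rightarrow> 'k::comm_ring_1 mpoly" where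
  "word_poly n i [] = 1"
| "word_poly n i (b # xs) = Var (i * n + b) * word_poly n (Suc i) xs"

lemma word_poly_append: "word_poly n i (xs @ ys) = word_poly n i xs * word_poly n (i + length xs) ys"
  by (induction xs arbitrary: i) (auto simp: mult.assoc)

lemma word_poly_eq:
  "word_poly n i xs =
    Poly_Mapping.single (\<Sum>k<length xs. Poly_Mapping.single ((i + k) * n + xs ! k) 1) 1"
proof (induction xs arbitrary: i)
  case (Cons b xs)
  show ?case
    by (simp add: Cons Var_def mult_single sum.lessThan_Suc_shift del: sum.lessThan_Suc)
qed simp

abbreviation nz :: "nat list \<Rightarrow> nat list" where
  "nz \<equiv> filter (\<lambda>a. a \<noteq> 0)"

text \<open>The letter 0 means that a position is skipped.\<close>

definition hard_poly :: "nat \<Rightarrow> nat \<Rightarrow> 'k::comm_ring_1 mpoly" where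
  "hard_poly n d =
    (\<Sum>xs\<in>{xs \<in> words n d. nz (take (d div 2) xs) = nz (drop (d div 2) xs)}. word_poly n 0 xs)"

text \<open>The part of the hard polynomial that remains to be computed when the first half is read from
  position \<open>i\<close> on, the second half from position \<open>p\<close> on, and the letter \<open>a\<close> still
  has to be matched in the second half; \<open>a = 0\<close> means that there is no pending letter.\<close>

definition tail_poly :: "nat \<Rightarrow> nat \<Rightarrow> nat \<Rightarrow> nat \<Rightarrow> nat \<Rightarrow> nat \<Rightarrow> 'k::comm_ring_1 mpoly" where
  "tail_poly n i u p v a = (\<Sum>xs\<in>words n u. \<Sum>ys\<in>words n v.
     if nz (a # xs) = nz ys then word_poly n i xs * word_poly n p ys else 0)"

text \<open>The letter \<open>b\<close> read in the first half becomes the pending one. Since 0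
  encodes both a skipped letter and the absence of a pending one, no case distinction
  arises.\<close>

lemma tail_poly_Suc_left:
  "tail_poly n i (Suc u) p v 0 = (\<Sum>b<n. Var (i * n + b) * tail_poly n (Suc i) u p v b)"
  by (simp add: tail_poly_def sum_words_Suc sum_distrib_left if_distrib mult.assoc cong: if_cong)

text \<open>The next letter of the second half is 0 and is skipped, or it matches \<open>a\<close>.
  With \<open>a = 0\<close> the first half must be exhausted, as otherwise a nonzero letter of the
  second half could match a letter not yet read.\<close>

lemma tail_poly_Suc_right:
  assumes "a \<noteq> 0 \<or> u = 0" "a < n"
  shows "tail_poly n i u p (Suc v) a = Var (p * n) * tail_poly n i u (Suc p) v a +
    (if a \<noteq> 0 then Var (p * n + a) * tail_poly n i u (Suc p) v 0 else 0)"
proof -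
  \<comment> \<open>\<open>F b xs\<close> collects the words of the second half that begin with
    \<open>b\<close>; only \<open>b = 0\<close> and \<open>b = a\<close> contribute.\<close>
  define F where "F b xs = (\<Sum>ys\<in>words n v. if nz (a # xs) = nz (b # ys)
    then word_poly n i xs * word_poly n p (b # ys) else (0 :: 'a mpoly))" for b xs
  have F0: "(\<Sum>xs\<in>words n u. F 0 xs) = Var (p * n) * tail_poly n i u (Suc p) v a"
    by (simp add: F_def tail_poly_def sum_distrib_left if_distrib mult_ac cong: if_cong)
  have Fa: "(\<Sum>xs\<in>words n u. F a xs) = Var (p * n + a) * tail_poly n i u (Suc p) v 0" if "a \<noteq> 0"
    using that by (simp add: F_def tail_poly_def sum_distrib_left if_distrib mult_ac cong: if_cong)
  have F_other: "F b xs = 0" if "b \<noteq> 0" "b \<noteq> a" "xs \<in> words n u" for b xs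
    using that assms(1) by (auto simp: F_def intro!: sum.neutral)
  have "(\<Sum>b<n. F b xs) = (\<Sum>b\<in>{0, a}. F b xs)" if "xs \<in> words n u" for xs
    using assms(2) F_other that by (intro sum.mono_neutral_right) auto
  then have "tail_poly n i u p (Suc v) a = (\<Sum>xs\<in>words n u. \<Sum>b\<in>{0, a}. F b xs)"
    unfolding tail_poly_def sum_words_Suc F_def[symmetric] by simp
  also have "\<dots> = (\<Sum>b\<in>{0, a}. \<Sum>xs\<in>words n u. F b xs)"
    by (rule sum.swap)
  finally show ?thesis using F0 Fa by (cases "a = 0") auto
qed

lemma tail_poly_pending: "a \<noteq> 0 \<Longrightarrow> tail_poly n i u p 0 a = 0"
  by (simp add: tail_poly_def)

lemma tail_poly_Nil: "tail_poly n i 0 p 0 0 = 1"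
  by (simp add: tail_poly_def)

lemma hard_poly_eq_tail_poly:
  "hard_poly n d = tail_poly n 0 (d div 2) (d div 2) (d - d div 2) 0"
proof -
  define h where "h = d div 2"
  have d: "d = h + (d - h)" by (simp add: h_def)
  have "hard_poly n d = (\<Sum>xs\<in>words n (h + (d - h)).
      if nz (take h xs) = nz (drop h xs) then word_poly n 0 xs else 0)"
    unfolding hard_poly_def h_def[symmetric] d[symmetric] by (simp add: sum.inter_filter)
  also have "\<dots> = (\<Sum>xs\<in>words n h. \<Sum>ys\<in>words n (d - h). if nz (take h (xs @ ys)) = nz (drop h (xs @ ys))
      then word_poly n 0 (xs @ ys) else 0)"
    by (rule sum_words_add)
  also have "\<dots> = tail_poly n 0 h h (d - h) 0"
    unfolding tail_poly_def
    by (intro sum.cong refl) (auto simp: words_def word_poly_append)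
  finally show ?thesis by (simp add: h_def)
qed

section \<open>A branching program of polynomial size\<close>

text \<open>In layer \<open>l\<close> the state \<open>(i, a)\<close> has read \<open>i\<close>
  letters of the first half, hence \<open>l - i\<close> of the second, so the second pointer
  \<open>p\<close> is not stored. With nothing pending the edge reads position \<open>i\<close> and
  makes its letter pending. Otherwise, or when the first half is exhausted, it reads position
  \<open>p\<close>, where the letter is 0 (\<open>a' = a\<close>) or the pending one
  (\<open>a' = 0\<close>).\<close>

definition hard_label :: "nat \<Rightarrow> nat \<Rightarrow> nat \<Rightarrow> nat \<Rightarrow> nat \<Rightarrow> nat \<Rightarrow> nat \<Rightarrow> 'k::comm_ring_1 mpoly" where
  "hard_label n d l i a i' a' =
    (let h = d div 2; p = h + (l - i) in
     if a = 0 \<and> i < h then (if i' = Suc i then Var (i * n + a') else 0)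
     else if i \<le> l \<and> p < d \<and> i' = i then
       (if a' = a then Var (p * n) else if a' = 0 then Var (p * n + a) else 0)
     else 0)"

text \<open>The guards give 0 to states that no run reaches: for \<open>i > l\<close> or
  \<open>p > d\<close> the truncated differences would no longer count letters.\<close>

definition hard_tail :: "nat \<Rightarrow> nat \<Rightarrow> nat \<Rightarrow> nat \<Rightarrow> nat \<Rightarrow> 'k::comm_ring_1 mpoly" where
  "hard_tail n d l i a =
    (let h = d div 2; p = h + (l - i) in
     if i \<le> l \<and> p \<le> d then tail_poly n i (h - i) p (d - p) a else 0)"

lemma sum_only: "finite S \<Longrightarrow> x \<in> S \<Longrightarrow> (\<And>y. y \<in> S \<Longrightarrow> y \<noteq> x \<Longrightarrow> f y = 0) \<Longrightarrow> sum f S = f x"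
  by (subst sum.mono_neutral_right[of S "{x}"]) auto

text \<open>The two kinds of edges realise the recursions \<open>tail_poly_Suc_left\<close> and
  \<open>tail_poly_Suc_right\<close>; which one applies depends only on \<open>a\<close> and
  \<open>i\<close>.\<close>

lemma hard_tail_step:
  assumes "l < d" "i < Suc (d div 2)" "a < n"
  shows "(hard_tail n d l i a :: 'k::comm_ring_1 mpoly) =
    (\<Sum>i'<Suc (d div 2). \<Sum>a'<n. hard_label n d l i a i' a' * hard_tail n d (Suc l) i' a')"
proof -
  define h where "h = d div 2"
  define p where "p = h + (l - i)"
  let ?label = "\<lambda>i' a'. hard_label n d l i a i' a' :: 'k mpoly"
  let ?tail = "\<lambda>i' a'. hard_tail n d (Suc l) i' a' :: 'k mpoly"
  have h: "i \<le> h" using assms by (simp add: h_def)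
  have tail: "hard_tail n d l i a =
      (if i \<le> l \<and> p \<le> d then tail_poly n i (h - i) p (d - p) a else 0 :: 'k mpoly)"
    unfolding hard_tail_def Let_def h_def p_def by simp
  show ?thesis
  proof (cases "a = 0 \<and> i < h")
    case True
    have label: "?label i' a' = (if i' = Suc i then Var (i * n + a') else 0)" for i' a'
      using True unfolding hard_label_def Let_def h_def[symmetric] by simp
    have tail_next: "?tail (Suc i) a' =
        (if i \<le> l \<and> p \<le> d then tail_poly n (Suc i) (h - Suc i) p (d - p) a' else 0)" for a'
      unfolding hard_tail_def Let_def h_def p_def diff_Suc_Suc Suc_le_mono by (rule refl)
    have "Suc i < Suc h" using True by simp
    then have "(\<Sum>i'<Suc h. \<Sum>a'<n. ?label i' a' * ?tail i' a') = (\<Sum>a'<n. ?label (Suc i) a' * ?tail (Suc i) a')"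
      by (intro sum_only) (auto simp: label)
    also have "\<dots> = (if i \<le> l \<and> p \<le> d then tail_poly n i (Suc (h - Suc i)) p (d - p) 0 else 0)"
      by (cases "i \<le> l \<and> p \<le> d") (auto simp: label tail_next tail_poly_Suc_left)
    also have "\<dots> = hard_tail n d l i a"
      using True tail by (simp add: Suc_diff_Suc)
    finally show ?thesis by (simp add: h_def)
  next
    case False
    have label: "?label i' a' = (if i \<le> l \<and> p < d \<and> i' = i then
       (if a' = a then Var (p * n) else if a' = 0 then Var (p * n + a) else 0) else 0)" for i' a'
      using False unfolding hard_label_def Let_def h_def[symmetric] p_def[symmetric] by auto
    have only: "(\<Sum>i'<Suc h. \<Sum>a'<n. ?label i' a' * ?tail i' a') = (\<Sum>a'<n. ?label i a' * ?tail i a')"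
      using h by (intro sum_only) (auto simp: label)
    show ?thesis
    proof (cases "i \<le> l \<and> p < d")
      case True
      have "h + (Suc l - i) = Suc p" using True unfolding p_def by arith
      then have tail_next: "?tail i a' = tail_poly n i (h - i) (Suc p) (d - Suc p) a'" for a'
        using True unfolding hard_tail_def Let_def h_def[symmetric] by simp
      have "(\<Sum>a'<n. ?label i a' * ?tail i a') = (\<Sum>a'\<in>{a, 0}. ?label i a' * ?tail i a')"
        using assms(3) by (intro sum.mono_neutral_right) (auto simp: label)
      also have "\<dots> = Var (p * n) * tail_poly n i (h - i) (Suc p) (d - Suc p) a +
          (if a \<noteq> 0 then Var (p * n + a) * tail_poly n i (h - i) (Suc p) (d - Suc p) 0 else 0)"
        using True label[of i 0] label[of i a] by (cases "a = 0") (auto simp: tail_next)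
      also have "\<dots> = tail_poly n i (h - i) p (Suc (d - Suc p)) a"
        using False h assms(3) by (intro tail_poly_Suc_right[symmetric]) auto
      also have "\<dots> = hard_tail n d l i a"
        using True by (simp add: tail Suc_diff_Suc)
      finally show ?thesis using only by (simp add: h_def)
    next
      case out: False
      have "hard_tail n d l i a = (0 :: 'k mpoly)"
      proof (cases "i \<le> l \<and> p \<le> d")
        case True
        then have "p = d" using out by simp
        \<comment> \<open>If nothing were pending, then \<open>i = h\<close> and hence
          \<open>l = d\<close>. So a letter is pending while the second half is exhausted, and the
          tail is 0.\<close>
        then have "a \<noteq> 0" using False h True assms(1) by (auto simp: p_def)
        then show ?thesis
          by (simp add: tail \<open>p = d\<close> tail_poly_pending)
      qed (auto simp: tail)
      moreover have "(\<Sum>a'<n. ?label i a' * ?tail i a') = 0"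
        using out by (intro sum.neutral) (auto simp: label)
      ultimately show ?thesis using only by (simp add: h_def)
    qed
  qed
qed

lemma sum_div_mod:
  fixes f :: "nat \<Rightarrow> nat \<Rightarrow> 'b::comm_monoid_add"
  assumes "n > 0"
  shows "(\<Sum>k<m * n. f (k div n) (k mod n)) = (\<Sum>i<m. \<Sum>a<n. f i a)"
proof -
  have "(\<Sum>k<m * n. f (k div n) (k mod n)) = (\<Sum>i<m. \<Sum>k\<in>{i * n..<i * n + n}. f (k div n) (k mod n))"
    by (rule sum.nat_group[symmetric])
  also have "\<dots> = (\<Sum>i<m. \<Sum>a<n. f i a)"
  proof (rule sum.cong[OF refl])
    fix i
    have "k div n = i \<and> k mod n = k - i * n" if "i * n \<le> k" "k < i * n + n" for k
    proof -
      have "k = i * n + (k - i * n)" "k - i * n < n" using that by auto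
      then show ?thesis by (metis assms div_mult_self3 div_less add.commute add.right_neutral
            gr_implies_not0 mod_mult_self3 mod_less)
    qed
    then show "(\<Sum>k\<in>{i * n..<i * n + n}. f (k div n) (k mod n)) = (\<Sum>a<n. f i a)"
      by (intro sum.reindex_bij_witness[of _ "\<lambda>a. i * n + a" "\<lambda>k. k - i * n"]) auto
  qed
  finally show ?thesis .
qed

text \<open>State \<open>(i, a)\<close> gets the number \<open>i * n + a\<close>. With
  \<open>h = d div 2\<close>, the final state is \<open>h * n\<close>: first half exhausted and
  nothing pending.\<close>

lemma hard_poly_abp:
  assumes "d \<ge> 1" "n \<ge> 1"
  shows "\<exists>A. abp_wf A \<and> abp_poly A = (hard_poly n d :: 'k::comm_ring_1 mpoly) \<and> abp_size A \<le> (d + 1) * (Suc (d div 2) * n)"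
proof -
  define h where "h = d div 2"
  have h: "h \<le> d" by (simp add: h_def)
  define D where "D l k k' = (hard_label n d l (k div n) (k mod n) (k' div n) (k' mod n) :: 'k mpoly)" for l k k'
  define Q where "Q l k = (hard_tail n d l (k div n) (k mod n) :: 'k mpoly)" for l k
  have linear: "is_linear_poly (D l k k')" for l k k'
    by (simp add: D_def hard_label_def Let_def is_linear_poly_Var is_linear_poly_0)
  have step: "Q l k = (\<Sum>k'<Suc h * n. D l k k' * Q (Suc l) k')" if "l < d" "k < Suc h * n" for l k
  proof -
    have "k div n < Suc h" using that(2) by (rule less_mult_imp_div_less)
    then have "Q l k = (\<Sum>i'<Suc h. \<Sum>a'<n. hard_label n d l (k div n) (k mod n) i' a' *
        hard_tail n d (Suc l) i' a')"
      unfolding Q_def h_def using that(1) assms(2) by (intro hard_tail_step) auto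
    then show ?thesis
      unfolding Q_def D_def using assms(2) by (subst sum_div_mod) auto
  qed
  have final: "Q d k = (if k = h * n then 1 else 0)" if "k < Suc h * n" for k
  proof -
    have "k div n < Suc h" using that by (rule less_mult_imp_div_less)
    \<comment> \<open>In layer \<open>d\<close> a state with \<open>i < h\<close> would have read
      more letters of the second half than there are.\<close>
    then have "h + (d - k div n) \<le> d \<longleftrightarrow> k div n = h" using h by linarith
    moreover have "k = h * n \<longleftrightarrow> k div n = h \<and> k mod n = 0"
      using assms(2) div_mult_mod_eq[of k n] by auto
    ultimately show ?thesis
      using h unfolding Q_def hard_tail_def Let_def h_def[symmetric]
      by (auto simp: tail_poly_Nil tail_poly_pending)
  qed
  have "0 < Suc h * n" "h * n < Suc h * n" using assms by simp_all
  note abp_of_transition_system[where D = D and Q = Q, OF assms(1) this linear step final]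
  moreover have "Q 0 0 = hard_poly n d"
    using h by (simp add: Q_def hard_tail_def Let_def h_def[symmetric] hard_poly_eq_tail_poly)
  ultimately show ?thesis by (simp add: h_def)
qed

section \<open>The coefficient matrix of the hard polynomial\<close>

lemma word_poly_eq_word_monom:
  "word_poly n 0 xs = Poly_Mapping.single (word_monom n {..<length xs} ((!) xs)) 1"
  by (simp add: word_poly_eq word_monom_def)

lemma hard_poly_coeff:
  assumes "\<And>i. i < d \<Longrightarrow> s i < n"
  shows "Poly_Mapping.lookup (hard_poly n d) (word_monom n {..<d} s) =
    (if nz (map s [0..<d div 2]) = nz (map s [d div 2..<d]) then 1 else 0)"
proof -
  define W where "W = {xs \<in> words n d. nz (take (d div 2) xs) = nz (drop (d div 2) xs)}"
  let ?s = "map s [0..<d]"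
  have [simp]: "finite W" by (simp add: W_def)
  have monom: "word_monom n {..<length xs} ((!) xs) = word_monom n {..<d} s \<longleftrightarrow> xs = ?s" if "xs \<in> W" for xs
  proof -
    have xs: "length xs = d" "\<And>i. i < d \<Longrightarrow> xs ! i < n"
      using that by (force simp: W_def words_def)+
    then have "word_monom n {..<d} ((!) xs) = word_monom n {..<d} s \<longleftrightarrow> (\<forall>i\<in>{..<d}. xs ! i = s i)"
      using assms by (intro word_monom_eq_iff) auto
    also have "\<dots> \<longleftrightarrow> xs = ?s" using xs(1) by (auto simp: list_eq_iff_nth_eq)
    finally show ?thesis by (simp add: xs(1))
  qed
  have "Poly_Mapping.lookup (hard_poly n d) (word_monom n {..<d} s) = (\<Sum>xs\<in>W. if xs = ?s then 1 else 0)"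
    unfolding hard_poly_def W_def[symmetric] lookup_sum word_poly_eq_word_monom lookup_single when_def
    by (intro sum.cong refl) (simp add: monom)
  also have "\<dots> = (if ?s \<in> W then 1 else 0)" by simp
  also have "?s \<in> W \<longleftrightarrow> nz (map s [0..<d div 2]) = nz (map s [d div 2..<d])"
    using assms by (auto simp: W_def words_def take_map drop_map)
  finally show ?thesis .
qed

lemma set_multilinear_hard_poly: "set_multilinear (var_blocks n d) (hard_poly n d :: 'k::comm_ring_1 mpoly)"
  unfolding set_multilinear_def
proof
  fix \<mu> assume "\<mu> \<in> Poly_Mapping.keys (hard_poly n d :: 'k mpoly)"
  then obtain xs where xs: "xs \<in> words n d" "\<mu> \<in> Poly_Mapping.keys (word_poly n 0 xs :: 'k mpoly)"
  proof -
    have "Poly_Mapping.keys (hard_poly n d :: 'k mpoly) \<subseteq>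
        (\<Union>xs\<in>{xs \<in> words n d. nz (take (d div 2) xs) = nz (drop (d div 2) xs)}.
          Poly_Mapping.keys (word_poly n 0 xs :: 'k mpoly))"
      unfolding hard_poly_def by (rule keys_sum)
    with \<open>\<mu> \<in> _\<close> that show ?thesis by blast
  qed
  then have \<mu>: "\<mu> = word_monom n {..<d} ((!) xs)"
    by (auto simp: word_poly_eq_word_monom words_def split: if_splits)
  have less: "xs ! i < n" if "i < d" for i using xs that by (force simp: words_def)
  have "v \<in> \<Union>(set (var_blocks n d))" if v: "v \<in> Poly_Mapping.keys \<mu>" for v
  proof -
    obtain i where "i < d" "v = i * n + xs ! i"
    proof -
      have "Poly_Mapping.keys \<mu> \<subseteq>
          (\<Union>i<d. Poly_Mapping.keys (Poly_Mapping.single (i * n + xs ! i) (1 :: nat)))"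
        unfolding \<mu> word_monom_def by (rule keys_sum)
      with v that show ?thesis by auto
    qed
    then show ?thesis using less[of i] by (force simp: var_blocks_def)
  qed
  moreover have "(\<Sum>v\<in>var_blocks n d ! i. Poly_Mapping.lookup \<mu> v) = 1" if "i < d" for i
  proof -
    have "(\<Sum>v\<in>var_blocks n d ! i. Poly_Mapping.lookup \<mu> v) = (\<Sum>b<n. Poly_Mapping.lookup \<mu> (i * n + b))"
      unfolding nth_var_blocks[OF that]
      by (rule sum.reindex_bij_witness[of _ "\<lambda>b. i * n + b" "\<lambda>v. v - i * n"]) auto
    also have "\<dots> = (\<Sum>b<n. if xs ! i = b then 1 else 0)"
      unfolding \<mu> using that less by (intro sum.cong refl lookup_word_monom) auto
    finally show ?thesis using less[OF that] by simp
  qed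
  ultimately show "(\<forall>v\<in>Poly_Mapping.keys \<mu>. v \<in> \<Union>(set (var_blocks n d))) \<and>
      (\<forall>i<length (var_blocks n d). (\<Sum>v\<in>var_blocks n d ! i. Poly_Mapping.lookup \<mu> v) = 1)"
    by simp
qed

text \<open>All letters of \<open>y\<close> and \<open>z\<close> are nonzero, so deleting the letter
  0 from the two halves leaves \<open>y\<close> and \<open>z\<close>, listed in the order of the
  positions.\<close>

lemma hard_poly_coeff_combine:
  assumes "U \<subseteq> {..<d div 2}" "V \<subseteq> {d div 2..<d}" "n \<ge> 2"
    and "y \<in> Pi\<^sub>E U (\<lambda>_. {1..<n})" "z \<in> Pi\<^sub>E V (\<lambda>_. {1..<n})"
  shows "Poly_Mapping.lookup (hard_poly n d) (word_monom n {..<d} (combine U V y z)) =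
    (if map y (filter (\<lambda>i. i \<in> U) [0..<d div 2]) = map z (filter (\<lambda>i. i \<in> V) [d div 2..<d])
     then 1 else 0)"
proof -
  have "nz (map (combine U V y z) [0..<d div 2]) = map y (filter (\<lambda>i. i \<in> U) [0..<d div 2])"
    unfolding filter_map o_def
    using assms(2,4) by (intro map_cong filter_cong refl) (auto simp: combine_def PiE_iff)
  moreover have "nz (map (combine U V y z) [d div 2..<d]) = map z (filter (\<lambda>i. i \<in> V) [d div 2..<d])"
    unfolding filter_map o_def
    using assms(1,5) by (intro map_cong filter_cong refl) (auto simp: combine_def PiE_iff)
  moreover have "combine U V y z i < n" for i
    using assms(3-5) by (auto simp: combine_def PiE_iff)
  ultimately show ?thesis by (simp add: hard_poly_coeff)
qed

lemma map_map_of_zip: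
  assumes "distinct xs" "length xs = length ys"
  shows "map (\<lambda>x. the (map_of (zip xs ys) x)) xs = ys"
  using assms by (auto simp: list_eq_iff_nth_eq map_of_zip_nth)

text \<open>Listing \<open>U\<close> and \<open>V\<close> in increasing order turns rows and columns
  into lists of length \<open>p\<close> over \<open>{1..<n}\<close>. An entry is 1 exactly when the
  two lists agree, so the matrix is the identity of size \<open>(n - 1) ^ p\<close>.\<close>

lemma hard_poly_rank:
  assumes UV: "U \<subseteq> {..<d div 2}" "V \<subseteq> {d div 2..<d}" "n \<ge> 2" "card U = p" "card V = p"
    and "rank_le r (Pi\<^sub>E U (\<lambda>_. {1..<n})) (Pi\<^sub>E V (\<lambda>_. {1..<n}))
      (\<lambda>y z. Poly_Mapping.lookup (hard_poly n d :: 'k::field mpoly) (word_monom n {..<d} (combine U V y z)))"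
  shows "(n - 1) ^ p \<le> r"
proof -
  define us where "us = filter (\<lambda>i. i \<in> U) [0..<d div 2]"
  define vs where "vs = filter (\<lambda>i. i \<in> V) [d div 2..<d]"
  have us_set: "distinct us" "set us = U"
    using UV(1) by (auto simp: us_def)
  have us: "distinct us" "set us = U" "length us = p"
    using us_set distinct_card[of us] UV(4) by auto
  have vs_set: "distinct vs" "set vs = V"
    using UV(2) by (auto simp: vs_def)
  have vs: "distinct vs" "set vs = V" "length vs = p"
    using vs_set distinct_card[of vs] UV(5) by auto
  define I where "I = {xs. set xs \<subseteq> {1..<n} \<and> length xs = p}"
  \<comment> \<open>\<open>f D ds xs\<close> is the function on \<open>D\<close> whose values along
    the list \<open>ds\<close> are \<open>xs\<close>.\<close>
  define f where "f D ds xs = restrict (\<lambda>i. the (map_of (zip ds xs) i)) D" for D :: "nat set" and ds xs :: "nat list"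
  have map_f: "map (f D ds xs) ds = xs" if "distinct ds" "set ds = D" "length ds = p" "xs \<in> I" for D ds xs
  proof -
    have "map (f D ds xs) ds = map (\<lambda>i. the (map_of (zip ds xs) i)) ds"
      using that(2) by (intro map_cong) (auto simp: f_def)
    also have "\<dots> = xs" using that by (intro map_map_of_zip) (auto simp: I_def)
    finally show ?thesis .
  qed
  have f_PiE: "f D ds ` I \<subseteq> Pi\<^sub>E D (\<lambda>_. {1..<n})" if ds: "distinct ds" "set ds = D" "length ds = p" for D ds
  proof
    fix g assume "g \<in> f D ds ` I"
    then obtain xs where xs: "xs \<in> I" "g = f D ds xs" by auto
    have "g ` D = set (map (f D ds xs) ds)" using ds(2) xs(2) by simp
    also have "\<dots> = set xs" using map_f[OF ds xs(1)] by simp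
    finally have "g ` D \<subseteq> {1..<n}" using xs(1) by (simp add: I_def)
    then show "g \<in> Pi\<^sub>E D (\<lambda>_. {1..<n})" by (auto simp: xs(2) f_def PiE_iff)
  qed
  have "rank_le r I I (\<lambda>xs ys. Poly_Mapping.lookup (hard_poly n d :: 'k mpoly)
      (word_monom n {..<d} (combine U V (f U us xs) (f V vs ys))))"
    by (rule rank_le_reindex[OF assms(6) f_PiE[OF us] f_PiE[OF vs]])
  moreover have "Poly_Mapping.lookup (hard_poly n d :: 'k mpoly)
      (word_monom n {..<d} (combine U V (f U us xs) (f V vs ys))) = (if xs = ys then 1 else 0)"
    if "xs \<in> I" "ys \<in> I" for xs ys
  proof -
    have "f U us xs \<in> Pi\<^sub>E U (\<lambda>_. {1..<n})" "f V vs ys \<in> Pi\<^sub>E V (\<lambda>_. {1..<n})"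
      using f_PiE[OF us] f_PiE[OF vs] that by auto
    then show ?thesis
      using map_f[OF us that(1)] map_f[OF vs that(2)]
      by (subst hard_poly_coeff_combine[OF UV(1-3)]) (auto simp: us_def[symmetric] vs_def[symmetric])
  qed
  ultimately have "rank_le r I I (\<lambda>xs ys. if xs = ys then 1 else 0 :: 'k)"
    by (rule rank_le_cong)
  then have "card I \<le> r"
    by (rule rank_le_identity[rotated]) (simp add: I_def finite_lists_length_eq)
  then show ?thesis by (simp add: I_def card_lists_length_eq)
qed

section \<open>Unbalanced blocks\<close>

text \<open>The bound 4^m / sqrt(2m + 1) for the central binomial coefficient, squared to stay in
  the natural numbers. In the induction step the coefficient grows by the factor 2(2m + 1)/(m + 1),
  and (2m + 1)(2m + 3) is at most (2m + 2)^2.\<close>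

lemma central_binomial_square_le: "(2 * m choose m) ^ 2 * (2 * m + 1) \<le> 16 ^ m"
proof (induction m)
  case (Suc m)
  let ?c = "2 * m choose m" and ?c' = "2 * Suc m choose Suc m"
  have "Suc m * ?c' = (2 * m + 2) * (Suc (2 * m) choose m)"
    using Suc_times_binomial[of m "Suc (2 * m)"] by simp
  then have "Suc m * ?c' = Suc m * (2 * (Suc (2 * m) choose m))" by (simp add: algebra_simps)
  then have c': "?c' = 2 * (Suc (2 * m) choose m)" by (metis nat.distinct(1) mult_cancel1)
  have "Suc m * (Suc (2 * m) choose Suc m) = Suc (2 * m) * ?c"
    by (rule Suc_times_binomial)
  moreover have "Suc (2 * m) choose Suc m = Suc (2 * m) choose m"
    using binomial_symmetric[of "Suc m" "Suc (2 * m)"] by (simp del: binomial_Suc_Suc)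
  ultimately have "Suc m * (Suc (2 * m) choose m) = (2 * m + 1) * ?c" by (simp del: binomial_Suc_Suc)
  then have eq: "Suc m * ?c' = 2 * (2 * m + 1) * ?c"
    unfolding c' by (simp only: mult.assoc mult.left_commute[of "Suc m"])
  have "Suc m ^ 2 * (?c' ^ 2 * (2 * Suc m + 1)) = (Suc m * ?c') ^ 2 * (2 * m + 3)"
  proof -
    have "2 * Suc m + 1 = 2 * m + 3" by simp
    then show ?thesis by (simp only: power_mult_distrib mult.assoc)
  qed
  also have "\<dots> = 4 * ((2 * m + 1) * (2 * m + 3)) * (?c ^ 2 * (2 * m + 1))"
  proof -
    have "(2 * x * c) ^ 2 * y = 4 * (x * y) * (c ^ 2 * x)" for x y c :: nat
      by (simp add: power2_eq_square mult_ac)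
    then show ?thesis unfolding eq .
  qed
  also have "\<dots> \<le> 4 * ((2 * m + 1) * (2 * m + 3)) * 16 ^ m"
    using Suc.IH by (intro mult_left_mono) auto
  also have "\<dots> \<le> (16 * Suc m ^ 2) * 16 ^ m"
    by (intro mult_right_mono) (auto simp: power2_eq_square algebra_simps)
  also have "\<dots> = Suc m ^ 2 * 16 ^ Suc m" by simp
  finally show ?case unfolding mult_le_cancel1 by simp
qed simp

lemma central_binomial_small:
  assumes "C ^ 2 \<le> 2 * m + 1"
  shows "C * (2 * m choose m) \<le> 2 ^ (2 * m)"
proof -
  have "(C * (2 * m choose m)) ^ 2 \<le> (2 * m choose m) ^ 2 * (2 * m + 1)"
    unfolding power_mult_distrib mult.commute[of "C ^ 2"] using assms by (rule mult_left_mono) simp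
  also have "\<dots> \<le> 16 ^ m" by (rule central_binomial_square_le)
  also have "(16 :: nat) ^ m = (2 ^ 4) ^ m" by simp
  also have "\<dots> = 2 ^ (4 * m)" by (rule power_mult[symmetric])
  also have "\<dots> = 2 ^ (2 * m * 2)" by (rule arg_cong[of _ _ "(^) 2"]) simp
  also have "\<dots> = (2 ^ (2 * m)) ^ 2" by (rule power_mult)
  finally show ?thesis by (rule power2_le_imp_le) simp
qed

text \<open>The window contains at most \<open>8 * e\<close> sizes, each taken by at most
  \<open>2 * m choose m\<close> subsets. The constant 128 = 16 * 8 makes this at most a sixteenth of
  all subsets.\<close>

lemma card_Pow_window:
  assumes "finite B" "card B = 2 * m" "(128 * e) ^ 2 \<le> 2 * m + 1"
  shows "16 * card {Y \<in> Pow B. \<bar>int (card Y) - r\<bar> < 4 * int e} \<le> 2 ^ (2 * m)"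
proof -
  define K where "K = {k. \<bar>int k - r\<bar> < 4 * int e}"
  have K: "K \<subseteq> nat ` {r - 4 * int e<..<r + 4 * int e}"
  proof
    fix k assume "k \<in> K"
    then have "int k \<in> {r - 4 * int e<..<r + 4 * int e}" by (auto simp: K_def)
    then show "k \<in> nat ` {r - 4 * int e<..<r + 4 * int e}" by (metis image_eqI nat_int)
  qed
  then have "card K \<le> card (nat ` {r - 4 * int e<..<r + 4 * int e})"
    by (intro card_mono) auto
  also have "\<dots> \<le> card {r - 4 * int e<..<r + 4 * int e}" by (rule card_image_le) simp
  also have "\<dots> \<le> 8 * e" by simp
  finally have card_K: "card K \<le> 8 * e" .
  have "finite K" using K by (rule finite_subset) simp
  have "{Y \<in> Pow B. \<bar>int (card Y) - r\<bar> < 4 * int e} = (\<Union>k\<in>K. {Y. Y \<subseteq> B \<and> card Y = k})"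
    by (auto simp: K_def)
  then have "card {Y \<in> Pow B. \<bar>int (card Y) - r\<bar> < 4 * int e} \<le> (\<Sum>k\<in>K. card {Y. Y \<subseteq> B \<and> card Y = k})"
    using card_UN_le[OF \<open>finite K\<close>] by simp
  also have "\<dots> \<le> of_nat (card K) * (2 * m choose m)"
    using assms(1,2) by (intro sum_bounded_above) (simp add: n_subsets binomial_maximum')
  also have "\<dots> \<le> 8 * e * (2 * m choose m)"
    using card_K by simp
  finally have "16 * card {Y \<in> Pow B. \<bar>int (card Y) - r\<bar> < 4 * int e} \<le> 128 * e * (2 * m choose m)"
    by simp
  also have "\<dots> \<le> 2 ^ (2 * m)" using assms(3) by (rule central_binomial_small)
  finally show ?thesis .
qed

section \<open>Independence of disjoint blocks\<close>

lemma sum_Pow_disjoint_Un: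
  assumes "A \<inter> B = {}"
  shows "(\<Sum>W\<in>Pow (A \<union> B). f W) = (\<Sum>X\<in>Pow A. \<Sum>Y\<in>Pow B. f (X \<union> Y))"
proof -
  have "(\<Sum>W\<in>Pow (A \<union> B). f W) = (\<Sum>(X, Y)\<in>Pow A \<times> Pow B. f (X \<union> Y))"
    by (rule sum.reindex_bij_witness[of _ "\<lambda>(X, Y). X \<union> Y" "\<lambda>W. (W \<inter> A, W \<inter> B)"])
      (use assms in \<open>auto intro!: arg_cong[of _ _ f]\<close>)
  then show ?thesis by (simp add: sum.cartesian_product)
qed

text \<open>The traces of a uniformly random \<open>W\<close> on disjoint blocks are independent, so
  the sum over a product of weights factorises. The elements of \<open>C\<close>, which lie in no
  block, contribute the factor \<open>card (Pow C)\<close>.\<close>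

lemma sum_Pow_prod_blocks:
  fixes \<phi> :: "nat \<Rightarrow> 'a set \<Rightarrow> 'b::comm_semiring_1"
  assumes "\<And>t. t < q \<Longrightarrow> C \<inter> B t = {}"
    and "\<And>t t'. t < q \<Longrightarrow> t' < q \<Longrightarrow> t \<noteq> t' \<Longrightarrow> B t \<inter> B t' = {}"
  shows "(\<Sum>W\<in>Pow (C \<union> (\<Union>t<q. B t)). \<Prod>t<q. \<phi> t (W \<inter> B t))
    = of_nat (card (Pow C)) * (\<Prod>t<q. \<Sum>Y\<in>Pow (B t). \<phi> t Y)"
  using assms
proof (induction q)
  case (Suc q)
  let ?A = "C \<union> (\<Union>t<q. B t)"
  have "C \<inter> B q = {}" using Suc.prems(1) by simp
  moreover have "B t \<inter> B q = {}" if "t < q" for t using Suc.prems(2)[of t q] that by simp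
  ultimately have disj: "?A \<inter> B q = {}" by blast
  have "(\<Sum>W\<in>Pow (?A \<union> B q). \<Prod>t<Suc q. \<phi> t (W \<inter> B t))
      = (\<Sum>X\<in>Pow ?A. \<Sum>Y\<in>Pow (B q). \<Prod>t<Suc q. \<phi> t ((X \<union> Y) \<inter> B t))"
    by (rule sum_Pow_disjoint_Un[OF disj])
  also have "\<dots> = (\<Sum>X\<in>Pow ?A. \<Sum>Y\<in>Pow (B q). (\<Prod>t<q. \<phi> t (X \<inter> B t)) * \<phi> q Y)"
  proof (intro sum.cong refl)
    fix X Y assume XY: "X \<in> Pow ?A" "Y \<in> Pow (B q)"
    have "(X \<union> Y) \<inter> B q = Y" using XY disj by blast
    moreover have "(X \<union> Y) \<inter> B t = X \<inter> B t" if "t < q" for t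
    proof -
      have "B q \<inter> B t = {}" using Suc.prems(2)[of q t] that by simp
      then show ?thesis using XY by blast
    qed
    ultimately show "(\<Prod>t<Suc q. \<phi> t ((X \<union> Y) \<inter> B t)) = (\<Prod>t<q. \<phi> t (X \<inter> B t)) * \<phi> q Y"
      by simp
  qed
  also have "\<dots> = (\<Sum>X\<in>Pow ?A. \<Prod>t<q. \<phi> t (X \<inter> B t)) * (\<Sum>Y\<in>Pow (B q). \<phi> q Y)"
    by (simp add: sum_product)
  also have "(\<Sum>X\<in>Pow ?A. \<Prod>t<q. \<phi> t (X \<inter> B t)) = of_nat (card (Pow C)) * (\<Prod>t<q. \<Sum>Y\<in>Pow (B t). \<phi> t Y)"
    by (rule Suc.IH) (use Suc.prems in auto)
  also have "?A \<union> B q = C \<union> (\<Union>t<Suc q. B t)" by (auto simp: lessThan_Suc)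
  finally show ?case by (simp add: mult.assoc)
qed simp

text \<open>Exponential Markov inequality: give every exceptional block the weight 16.\<close>

lemma card_many_exceptional_blocks:
  assumes S: "finite S" "\<And>t. t < q \<Longrightarrow> B t \<subseteq> S"
    and disj: "\<And>t t'. t < q \<Longrightarrow> t' < q \<Longrightarrow> t \<noteq> t' \<Longrightarrow> B t \<inter> B t' = {}"
    and rare: "\<And>t. t < q \<Longrightarrow> 16 * card {Y \<in> Pow (B t). P t Y} \<le> 2 ^ card (B t)"
  shows "card {W \<in> Pow S. q \<le> 2 * card {t \<in> {..<q}. P t (W \<inter> B t)}} * 2 ^ q \<le> 2 ^ card S"
proof -
  define C where "C = S - (\<Union>t<q. B t)"
  define \<phi> where "\<phi> t Y = (if P t Y then 16 else 1 :: nat)" for t Y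
  let ?F = "{W \<in> Pow S. q \<le> 2 * card {t \<in> {..<q}. P t (W \<inter> B t)}}"
  have fin: "finite (B t)" if "t < q" for t using S that finite_subset by blast
  have S_eq: "S = C \<union> (\<Union>t<q. B t)" using S(2) by (auto simp: C_def)
  have card_S: "card S = card C + (\<Sum>t<q. card (B t))"
  proof -
    have "card S = card C + card (\<Union>t<q. B t)"
      by (subst S_eq, rule card_Un_disjoint) (use S fin in \<open>auto simp: C_def\<close>)
    also have "card (\<Union>t<q. B t) = (\<Sum>t<q. card (B t))"
      using fin disj by (intro card_UN_disjoint) auto
    finally show ?thesis .
  qed
  \<comment> \<open>The average weight in a block is at most 2: an exceptional set weighs 16 but has
    probability at most 1/16.\<close>
  have block: "(\<Sum>Y\<in>Pow (B t). \<phi> t Y) \<le> 2 * 2 ^ card (B t)" if "t < q" for t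
  proof -
    have "(\<Sum>Y\<in>Pow (B t). \<phi> t Y) \<le> (\<Sum>Y\<in>Pow (B t). 1 + (if P t Y then 16 else 0))"
      by (intro sum_mono) (simp add: \<phi>_def)
    also have "\<dots> = (\<Sum>Y\<in>Pow (B t). 1) + (\<Sum>Y\<in>Pow (B t). if P t Y then 16 else 0)"
      by (rule sum.distrib)
    also have "\<dots> = card (Pow (B t)) + 16 * card {Y \<in> Pow (B t). P t Y}"
      using fin[OF that] by (subst sum.inter_filter[symmetric]) simp_all
    also have "\<dots> \<le> 2 * 2 ^ card (B t)"
      using rare[OF that] fin[OF that] by (simp add: card_Pow)
    finally show ?thesis .
  qed
  have "card ?F * 4 ^ q = (\<Sum>W\<in>?F. 4 ^ q)" by simp
  also have "\<dots> \<le> (\<Sum>W\<in>?F. \<Prod>t<q. \<phi> t (W \<inter> B t))"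
  proof (rule sum_mono)
    fix W assume "W \<in> ?F"
    \<comment> \<open>At least q/2 exceptional blocks give a total weight of at least 16^(q/2) =
      4^q, against an average of at most 2^q.\<close>
    then have "(4 :: nat) ^ q \<le> 4 ^ (2 * card {t \<in> {..<q}. P t (W \<inter> B t)})"
      by (intro power_increasing) auto
    also have "\<dots> = (\<Prod>t<q. \<phi> t (W \<inter> B t))"
      unfolding \<phi>_def by (subst prod.inter_filter[symmetric]) (simp_all add: power_mult)
    finally show "(4 :: nat) ^ q \<le> (\<Prod>t<q. \<phi> t (W \<inter> B t))" .
  qed
  also have "\<dots> \<le> (\<Sum>W\<in>Pow S. \<Prod>t<q. \<phi> t (W \<inter> B t))"
    using S(1) by (intro sum_mono2) auto
  also have "\<dots> = card (Pow C) * (\<Prod>t<q. \<Sum>Y\<in>Pow (B t). \<phi> t Y)"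
    unfolding S_eq by (subst sum_Pow_prod_blocks) (use disj in \<open>auto simp: C_def\<close>)
  also have "\<dots> \<le> card (Pow C) * (\<Prod>t<q. 2 * 2 ^ card (B t))"
    by (intro mult_left_mono prod_mono) (auto intro: block)
  also have "\<dots> = 2 ^ card S * 2 ^ q"
    using S(1) by (simp add: card_S prod.distrib power_sum power_add card_Pow C_def)
  finally have "(card ?F * 2 ^ q) * 2 ^ q \<le> 2 ^ card S * 2 ^ q"
    by (simp add: mult.assoc flip: power_mult_distrib)
  then show ?thesis by simp
qed

text \<open>The price of conditioning on the size of \<open>W\<close>: the middle coefficient is the
  largest of \<open>d + 1\<close> coefficients that add up to \<open>2 ^ d\<close>.\<close>

lemma middle_binomial_lower_bound: "2 ^ d \<le> (d + 1) * (d choose (d div 2))"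
proof -
  have "(2 :: nat) ^ d = (\<Sum>k\<le>d. d choose k)" by (rule choose_row_sum[symmetric])
  also have "\<dots> \<le> of_nat (card {..d}) * (d choose (d div 2))"
    by (intro sum_bounded_above binomial_maximum)
  finally show ?thesis by simp
qed

text \<open>The imbalance of \<open>U\<close> and \<open>V\<close> on a block \<open>B\<close> is expressed through the single
  random set \<open>W\<close> with \<open>U = W \<inter> {..<h}\<close> and \<open>V = {h..<d} - W\<close>.\<close>

lemma min_card_le:
  fixes W B :: "nat set"
  assumes "B \<subseteq> {..<d}" "h \<le> d" and "U = W \<inter> {..<h}" "V = {h..<d} - W"
  shows "2 * min (card (U \<inter> B)) (card (V \<inter> B)) +
      (if \<bar>int (card (W \<inter> B)) - int (card ({h..<d} \<inter> B))\<bar> < 4 * int e then 0 else 4 * e)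
    \<le> card (U \<inter> B) + card (V \<inter> B)"
proof -
  have fin: "finite B" using assms(1) finite_subset by blast
  \<comment> \<open>This count and the next share the term for
    \<open>W \<inter> {h..<d} \<inter> B\<close>. So the quantity in the window is the difference of
    \<open>card (U \<inter> B)\<close> and \<open>card (V \<inter> B)\<close>, and twice the smaller
    plus this distance is their sum.\<close>
  have "card (W \<inter> B) = card (U \<inter> B) + card (W \<inter> {h..<d} \<inter> B)"
    using assms fin by (subst card_Un_disjoint[symmetric]) (auto intro!: arg_cong[of _ _ card])
  moreover have "card ({h..<d} \<inter> B) = card (V \<inter> B) + card (W \<inter> {h..<d} \<inter> B)"
    using assms fin by (subst card_Un_disjoint[symmetric]) (auto intro!: arg_cong[of _ _ card])
  ultimately show ?thesis by (auto simp: min_def)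
qed

lemma sum_card_blocks:
  fixes bnd :: "nat \<Rightarrow> nat"
  assumes "\<sigma> permutes {..<d}" "U \<subseteq> {..<d}" and bnd: "bnd 0 = 0" "mono bnd" "bnd q = d"
  shows "(\<Sum>t<q. card (U \<inter> \<sigma> ` {bnd t..<bnd (Suc t)})) = card U"
proof -
  have "(\<Sum>t<k. card (U \<inter> \<sigma> ` {bnd t..<bnd (Suc t)})) = card (U \<inter> \<sigma> ` {..<bnd k})" for k
  proof (induction k)
    case (Suc k)
    have le: "bnd k \<le> bnd (Suc k)" using bnd(2) by (simp add: monoD)
    have "{..<bnd (Suc k)} = {..<bnd k} \<union> {bnd k..<bnd (Suc k)}" using ivl_disj_un_one(2)[OF le] by simp
    then have "card (U \<inter> \<sigma> ` {..<bnd (Suc k)})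
        = card ((U \<inter> \<sigma> ` {..<bnd k}) \<union> (U \<inter> \<sigma> ` {bnd k..<bnd (Suc k)}))"
      by (simp add: image_Un Int_Un_distrib)
    also have "\<dots> = card (U \<inter> \<sigma> ` {..<bnd k}) + card (U \<inter> \<sigma> ` {bnd k..<bnd (Suc k)})"
    proof (rule card_Un_disjoint)
      have "\<sigma> ` {..<bnd k} \<inter> \<sigma> ` {bnd k..<bnd (Suc k)} = \<sigma> ` ({..<bnd k} \<inter> {bnd k..<bnd (Suc k)})"
        by (rule image_Int[OF permutes_inj[OF assms(1)], symmetric])
      also have "{..<bnd k} \<inter> {bnd k..<bnd (Suc k)} = {}" by auto
      finally show "(U \<inter> \<sigma> ` {..<bnd k}) \<inter> (U \<inter> \<sigma> ` {bnd k..<bnd (Suc k)}) = {}" by blast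
    qed simp_all
    finally show ?case using Suc by simp
  qed (simp add: bnd)
  from this[of q] show ?thesis
    using assms(2) by (simp add: bnd permutes_image[OF assms(1)] Int_absorb2)
qed

section \<open>The lower bound\<close>

lemma lookup_sum_abp_poly:
  "Poly_Mapping.lookup (sum_abp_poly As) \<mu> = (\<Sum>A\<leftarrow>As. Poly_Mapping.lookup (abp_poly A) \<mu>)"
  unfolding sum_abp_poly_def by (induction As) (auto simp: lookup_add)

text \<open>Union bound, with \<open>q = d div b\<close>: for each permutation at most 2^d / 2^q
  sets are nearly balanced on half of the blocks or more, while at least 2^d / (d + 1) sets have
  \<open>d - d div 2\<close> elements. If there are few permutations, one of the latter sets is
  unbalanced for all of them.\<close>

lemma exists_unbalanced_set:
  fixes e :: nat
  assumes \<sigma>: "\<And>x. x \<in> set xs \<Longrightarrow> \<sigma> x permutes {..<d}"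
    and b: "b = 2 * m" "b > 0" "(128 * e) ^ 2 \<le> 2 * m + 1"
    and few: "length xs * (d + 1) < 2 ^ (d div b)"
  shows "\<exists>W\<subseteq>{..<d}. card W = d - d div 2 \<and> (\<forall>x\<in>set xs.
    2 * card {t \<in> {..<d div b}. \<bar>int (card (W \<inter> \<sigma> x ` {t * b..<Suc t * b}))
      - int (card ({d div 2..<d} \<inter> \<sigma> x ` {t * b..<Suc t * b}))\<bar> < 4 * int e} < d div b)"
proof (rule ccontr)
  define q where "q = d div b"
  define B where "B x t = \<sigma> x ` {t * b..<Suc t * b}" for x t
  define P where "P x t Y \<longleftrightarrow> \<bar>int (card Y) - int (card ({d div 2..<d} \<inter> B x t))\<bar> < 4 * int e"
    for x t and Y :: "nat set"
  define bad where "bad x = {W \<in> Pow {..<d}. q \<le> 2 * card {t \<in> {..<q}. P x t (W \<inter> B x t)}}" for x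
  define M where "M = {W. W \<subseteq> {..<d} \<and> card W = d - d div 2}"
  assume "\<not> ?thesis"
  then have "M \<subseteq> (\<Union>x\<in>set xs. bad x)"
    unfolding M_def bad_def P_def B_def q_def by (fastforce simp: not_less)
  then have "card M \<le> card (\<Union>x\<in>set xs. bad x)"
    by (intro card_mono) (auto simp: bad_def)
  also have "\<dots> \<le> (\<Sum>x\<in>set xs. card (bad x))" by (rule card_UN_le) simp
  finally have "card M * 2 ^ q \<le> (\<Sum>x\<in>set xs. card (bad x) * 2 ^ q)"
    by (simp flip: sum_distrib_right)
  also have "\<dots> \<le> (\<Sum>x\<in>set xs. 2 ^ d)"
  proof (rule sum_mono)
    fix x assume x: "x \<in> set xs"
    have inj: "inj (\<sigma> x)" using \<sigma>[OF x] by (rule permutes_inj)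
    have card_B: "card (B x t) = b" for t
      unfolding B_def using inj by (subst card_image) (auto intro: inj_on_subset)
    have le: "Suc t * b \<le> d" if "t < q" for t
    proof -
      have "Suc t * b \<le> q * b" using that by (intro mult_right_mono) auto
      also have "\<dots> \<le> d" by (simp add: q_def)
      finally show ?thesis .
    qed
    have "card (bad x) * 2 ^ q \<le> 2 ^ card {..<d}"
      unfolding bad_def
    proof (rule card_many_exceptional_blocks)
      show "B x t \<subseteq> {..<d}" if "t < q" for t
      proof -
        have "{t * b..<Suc t * b} \<subseteq> {..<d}" using le[OF that] by auto
        then have "B x t \<subseteq> \<sigma> x ` {..<d}" unfolding B_def by (rule image_mono)
        then show ?thesis using permutes_image[OF \<sigma>[OF x]] by simp
      qed
      show "B x t \<inter> B x t' = {}" if "t \<noteq> t'" for t t'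
      proof -
        have "Suc t * b \<le> t' * b \<or> Suc t' * b \<le> t * b"
          using that by (metis Suc_leI linorder_neqE_nat mult_le_mono1)
        then have "{t * b..<Suc t * b} \<inter> {t' * b..<Suc t' * b} = {}" by fastforce
        then show ?thesis
          unfolding B_def by (simp only: image_Int[OF inj, symmetric] image_empty)
      qed
      show "16 * card {Y \<in> Pow (B x t). P x t Y} \<le> 2 ^ card (B x t)" for t
        unfolding P_def card_B b(1)
        by (rule card_Pow_window) (use card_B[of t] b in \<open>auto simp: B_def\<close>)
    qed simp
    then show "card (bad x) * 2 ^ q \<le> 2 ^ d" by simp
  qed
  also have "\<dots> \<le> length xs * 2 ^ d" by (simp add: card_length)
  finally have "card M * 2 ^ q \<le> length xs * 2 ^ d" .
  moreover have "card M = d choose (d div 2)"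
    unfolding M_def using binomial_symmetric[of "d div 2" d] by (subst n_subsets) auto
  ultimately have "(d + 1) * (d choose (d div 2)) * 2 ^ q \<le> (length xs * (d + 1)) * 2 ^ d"
    by (metis mult.assoc mult.commute mult_le_mono2)
  moreover have "2 ^ d * 2 ^ q \<le> (d + 1) * (d choose (d div 2)) * 2 ^ q"
    by (intro mult_right_mono middle_binomial_lower_bound) simp
  moreover have "(length xs * (d + 1)) * 2 ^ d < 2 ^ d * 2 ^ q"
    using few by (simp add: q_def)
  ultimately show False by linarith
qed

text \<open>At least q/2 of the first \<open>q\<close> blocks are unbalanced by \<open>4 * e\<close>
  or more. There the minimum falls short of half the sum by \<open>2 * e\<close>, which gives
  \<open>q * e\<close> in total; in every other block the minimum is at most half the sum.\<close>

lemma sum_min_card_blocks_le: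
  fixes bnd :: "nat \<Rightarrow> nat"
  assumes \<sigma>: "\<sigma> permutes {..<d}" and bnd: "bnd 0 = 0" "mono bnd" "bnd (Suc q) = d"
    and "h \<le> d" and UV: "U = W \<inter> {..<h}" "V = {h..<d} - W" "card U = p" "card V = p"
    and few: "2 * card {t \<in> {..<q}. \<bar>int (card (W \<inter> \<sigma> ` {bnd t..<bnd (Suc t)}))
      - int (card ({h..<d} \<inter> \<sigma> ` {bnd t..<bnd (Suc t)}))\<bar> < 4 * int e} < q"
  shows "(\<Sum>t<Suc q. min (card (U \<inter> \<sigma> ` {bnd t..<bnd (Suc t)}))
      (card (V \<inter> \<sigma> ` {bnd t..<bnd (Suc t)}))) + q * e \<le> p"
proof -
  define B where "B t = \<sigma> ` {bnd t..<bnd (Suc t)}" for t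
  define P where "P t \<longleftrightarrow> \<bar>int (card (W \<inter> B t)) - int (card ({h..<d} \<inter> B t))\<bar> < 4 * int e" for t
  let ?mins = "\<Sum>t<Suc q. min (card (U \<inter> B t)) (card (V \<inter> B t))"
  have B: "B t \<subseteq> {..<d}" if "t < Suc q" for t
  proof -
    have "bnd (Suc t) \<le> d" using that bnd(2) by (metis Suc_leI bnd(3) monoD)
    then have "B t \<subseteq> \<sigma> ` {..<d}" unfolding B_def by (intro image_mono) auto
    then show ?thesis using permutes_image[OF \<sigma>] by simp
  qed
  have "card {t \<in> {..<q}. P t} + card {t \<in> {..<q}. \<not> P t} = q"
  proof -
    have "card {t \<in> {..<q}. P t} + card {t \<in> {..<q}. \<not> P t}
        = card ({t \<in> {..<q}. P t} \<union> {t \<in> {..<q}. \<not> P t})"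
      by (rule card_Un_disjoint[symmetric]) auto
    also have "{t \<in> {..<q}. P t} \<union> {t \<in> {..<q}. \<not> P t} = {..<q}" by auto
    finally show ?thesis by simp
  qed
  moreover have "2 * card {t \<in> {..<q}. P t} < q" using few unfolding P_def B_def .
  ultimately have good: "q \<le> 2 * card {t \<in> {..<q}. \<not> P t}" by simp
  have "(\<Sum>t<q. if P t then 0 else 4 * e) = (\<Sum>t\<in>{t \<in> {..<q}. \<not> P t}. 4 * e)"
    by (intro sum.mono_neutral_cong_right) auto
  then have "4 * (e * card {t \<in> {..<q}. \<not> P t}) \<le> (\<Sum>t<Suc q. if P t then 0 else 4 * e)"
    by simp
  moreover have "q * e \<le> 2 * (e * card {t \<in> {..<q}. \<not> P t})"
    using mult_le_mono1[OF good, of e] by (simp add: mult_ac)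
  moreover have "2 * ?mins + (\<Sum>t<Suc q. if P t then 0 else 4 * e)
      \<le> (\<Sum>t<Suc q. card (U \<inter> B t) + card (V \<inter> B t))"
    unfolding sum_distrib_left sum.distrib[symmetric] P_def
    using B by (intro sum_mono min_card_le[OF _ \<open>h \<le> d\<close> UV(1,2)]) simp
  moreover have "(\<Sum>t<Suc q. card (U \<inter> B t) + card (V \<inter> B t)) = 2 * p"
  proof -
    have "U \<subseteq> {..<d}" "V \<subseteq> {..<d}" using UV(1,2) \<open>h \<le> d\<close> by auto
    then show ?thesis
      unfolding sum.distrib B_def using UV(3,4) sum_card_blocks[OF \<sigma> _ bnd] by simp
  qed
  ultimately have "?mins + q * e \<le> p" by linarith
  then show ?thesis by (simp add: B_def)
qed

text \<open>If the summands were few, one \<open>W\<close> would be unbalanced for all of them. Each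
  would then have rank at most \<open>n ^ (c * (q + 1)) * (n - 1) ^ (p - q * e)\<close>, while the
  ranks have to add up to at least \<open>(n - 1) ^ p\<close>.\<close>

lemma sum_smabp_hard_poly_lower_bound:
  fixes As :: "'k::field abp list"
  assumes As: "sum_smabp (var_blocks n d) As" "sum_abp_poly As = hard_poly n d" "sm_max_width As \<le> n ^ c"
    and b: "b = 2 * m" "(128 * (4 * c + 1)) ^ 2 \<le> 2 * m + 1" "0 < b" "b \<le> d" and "n \<ge> 3"
  shows "2 ^ (d div b) \<le> length As * (d + 1)"
proof (rule ccontr)
  define q where "q = d div b"
  define h where "h = d div 2"
  define e where "e = 4 * c + 1"
  \<comment> \<open>There are \<open>q\<close> full blocks of length \<open>b\<close>; block number
    \<open>q\<close> takes the remaining positions.\<close>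
  define bnd where "bnd t = (if t \<le> q then t * b else d)" for t
  assume "\<not> ?thesis"
  then have few: "length As * (d + 1) < 2 ^ (d div b)" by simp
  have q: "q \<ge> 1" using b by (simp add: q_def div_greater_zero_iff Suc_leI)
  have qb: "q * b \<le> d" by (simp add: q_def)
  have "mono bnd"
  proof (rule monoI)
    fix t t' :: nat assume "t \<le> t'"
    then have "t * b \<le> t' * b" by (rule mult_le_mono1)
    moreover have "t * b \<le> d" if "t \<le> q" using mult_le_mono1[OF that] qb by (rule le_trans)
    ultimately show "bnd t \<le> bnd t'" using \<open>t \<le> t'\<close> by (simp add: bnd_def)
  qed
  then have bnd: "bnd 0 = 0" "mono bnd" "bnd (Suc q) = d" by (auto simp: bnd_def)
  obtain \<sigma> where \<sigma>: "\<And>A. A \<in> set As \<Longrightarrow> sm_abp (var_blocks n d) (\<sigma> A) A"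
    using As(1) unfolding sum_smabp_def by metis
  have perm: "\<sigma> A permutes {..<d}" if "A \<in> set As" for A
    using \<sigma>[OF that] by (auto simp: sm_abp_def split: prod.splits)
  have e: "(128 * e) ^ 2 \<le> 2 * m + 1" using b(2) by (simp only: e_def)
  from exists_unbalanced_set[where xs = As and \<sigma> = \<sigma>, OF perm b(1,3) e few]
  obtain W where W: "W \<subseteq> {..<d}" "card W = d - h" and unbalanced: "\<And>A. A \<in> set As \<Longrightarrow>
      2 * card {t \<in> {..<q}. \<bar>int (card (W \<inter> \<sigma> A ` {t * b..<Suc t * b}))
      - int (card ({h..<d} \<inter> \<sigma> A ` {t * b..<Suc t * b}))\<bar> < 4 * int e} < q"
    unfolding q_def[symmetric] h_def[symmetric] by blast
  define U where "U = W \<inter> {..<h}"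
  define V where "V = {h..<d} - W"
  define p where "p = card U"
  have hd: "h \<le> d" by (simp add: h_def)
  \<comment> \<open>Here the size \<open>d - h\<close> of \<open>W\<close> matters: \<open>V\<close>
    is what \<open>W\<close> misses of the second half, and this half has exactly
    \<open>d - h\<close> positions.\<close>
  have "card V = p"
  proof -
    have fin: "finite W" using W(1) finite_subset by blast
    have "card W = card U + card (W \<inter> {h..<d})"
      unfolding U_def using fin W(1)
      by (subst card_Un_disjoint[symmetric]) (auto intro!: arg_cong[of _ _ card])
    moreover have "card V + card (W \<inter> {h..<d}) = card (V \<union> (W \<inter> {h..<d}))"
      by (rule card_Un_disjoint[symmetric]) (auto simp: V_def)
    moreover have "V \<union> (W \<inter> {h..<d}) = {h..<d}" by (auto simp: V_def)
    ultimately show ?thesis using W(2) by (simp add: p_def)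
  qed
  have UV: "U \<subseteq> {..<h}" "V \<subseteq> {h..<d}" by (auto simp: U_def V_def)
  let ?I = "Pi\<^sub>E U (\<lambda>_. {1..<n})" and ?J = "Pi\<^sub>E V (\<lambda>_. {1..<n})"
  let ?coeff = "\<lambda>A y z. Poly_Mapping.lookup (abp_poly A) (word_monom n {..<d} (combine U V y z))"
  have qe: "q * e \<le> p" and rank: "rank_le ((n ^ c) ^ Suc q * (n - 1) ^ (p - q * e)) ?I ?J (?coeff A)"
    if A: "A \<in> set As" for A
  proof -
    let ?mins = "\<Sum>t<Suc q. min (card (U \<inter> \<sigma> A ` {bnd t..<bnd (Suc t)}))
      (card (V \<inter> \<sigma> A ` {bnd t..<bnd (Suc t)}))"
    have "{t \<in> {..<q}. \<bar>int (card (W \<inter> \<sigma> A ` {bnd t..<bnd (Suc t)}))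
      - int (card ({h..<d} \<inter> \<sigma> A ` {bnd t..<bnd (Suc t)}))\<bar> < 4 * int e} =
      {t \<in> {..<q}. \<bar>int (card (W \<inter> \<sigma> A ` {t * b..<Suc t * b}))
      - int (card ({h..<d} \<inter> \<sigma> A ` {t * b..<Suc t * b}))\<bar> < 4 * int e}"
      by (intro Collect_cong conj_cong refl) (simp add: bnd_def)
    then have mins: "?mins + q * e \<le> p"
      using unbalanced[OF A] \<open>card V = p\<close> hd
      by (intro sum_min_card_blocks_le[OF perm[OF A] bnd hd U_def V_def]) (simp_all add: p_def)
    then show "q * e \<le> p" by simp
    have "abp_width A \<le> n ^ c"
      using As(3) A unfolding sm_max_width_def by (subst (asm) Max_le_iff) auto
    then have "rank_le ((n ^ c) ^ Suc q * (n - 1) ^ ?mins) ?I ?J (?coeff A)"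
      using UV hd \<open>n \<ge> 3\<close> by (intro rank_le_sm_abp[OF \<sigma>[OF A] _ bnd]) (auto simp: U_def V_def)
    moreover have "(n - 1) ^ ?mins \<le> (n - 1) ^ (p - q * e)"
      using mins \<open>n \<ge> 3\<close> by (intro power_increasing) auto
    ultimately show "rank_le ((n ^ c) ^ Suc q * (n - 1) ^ (p - q * e)) ?I ?J (?coeff A)"
      by (elim rank_le_mono) (rule mult_le_mono2)
  qed
  have "rank_le (length As * ((n ^ c) ^ Suc q * (n - 1) ^ (p - q * e))) ?I ?J
      (\<lambda>y z. Poly_Mapping.lookup (hard_poly n d :: 'k mpoly) (word_monom n {..<d} (combine U V y z)))"
    unfolding As(2)[symmetric] lookup_sum_abp_poly by (rule rank_le_sum_list[OF rank])
  then have main: "(n - 1) ^ p \<le> length As * ((n ^ c) ^ Suc q * (n - 1) ^ (p - q * e))"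
    using UV \<open>card V = p\<close> \<open>n \<ge> 3\<close> unfolding h_def
    by (intro hard_poly_rank) (auto simp: p_def)
  \<comment> \<open>Without summands the right-hand side of \<open>main\<close> would be 0. A
    summand is needed because \<open>qe\<close> was obtained from one.\<close>
  then have "As \<noteq> []" using \<open>n \<ge> 3\<close> by auto
  then have "q * e \<le> p" using qe by (meson hd_in_set)
  \<comment> \<open>Powers of \<open>n\<close> from the width are converted into powers of
    \<open>n - 1\<close>, the base in which the loss is measured.\<close>
  have "n \<le> (n - 1) ^ 2"
  proof -
    have "n \<le> 2 * (n - 1)" using \<open>n \<ge> 3\<close> by simp
    also have "\<dots> \<le> (n - 1) * (n - 1)" using \<open>n \<ge> 3\<close> by (intro mult_right_mono) auto
    finally show ?thesis by (simp add: power2_eq_square)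
  qed
  then have "(n ^ c) ^ Suc q \<le> (((n - 1) ^ 2) ^ c) ^ Suc q" by (intro power_mono) auto
  also have "\<dots> = (n - 1) ^ (2 * c * Suc q)" by (simp only: power_mult)
  also have "\<dots> \<le> (n - 1) ^ (4 * c * q)"
  proof (rule power_increasing)
    have "2 * c * Suc q \<le> 2 * c * (2 * q)" using q by (intro mult_le_mono2) simp
    then show "2 * c * Suc q \<le> 4 * c * q" by simp
  qed (use \<open>n \<ge> 3\<close> in simp)
  finally have "(n - 1) ^ p \<le> length As * ((n - 1) ^ (4 * c * q) * (n - 1) ^ (p - q * e))"
    using main by (meson le_trans mult_le_mono1 mult_le_mono2)
  also have "\<dots> = length As * (n - 1) ^ (p - q)"
  proof -
    \<comment> \<open>Since \<open>e = 4 * c + 1\<close>, the loss \<open>q * e\<close> pays for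
      \<open>4 * c * q\<close> and leaves a surplus of \<open>q\<close>.\<close>
    have "4 * c * q + (p - q * e) = p - q" using \<open>q * e \<le> p\<close> by (simp add: e_def algebra_simps)
    then show ?thesis by (simp flip: power_add)
  qed
  finally have "(n - 1) ^ q * (n - 1) ^ (p - q) \<le> length As * (n - 1) ^ (p - q)"
    using \<open>q * e \<le> p\<close> by (simp add: e_def flip: power_add)
  then have "(n - 1) ^ q \<le> length As" using \<open>n \<ge> 3\<close> by simp
  moreover have "(2 :: nat) ^ q \<le> (n - 1) ^ q" using \<open>n \<ge> 3\<close> by (intro power_mono) auto
  ultimately have "2 ^ q \<le> length As * (d + 1)" by simp
  then show False using few by (simp add: q_def)
qed

text \<open>Every summand has width at least 1 because of its start node, so many summands force a
  large total width.\<close>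

lemma length_le_sm_total_width:
  assumes "sum_smabp X As"
  shows "length As \<le> sm_total_width As"
proof -
  have "1 \<le> abp_width A" if "A \<in> set As" for A
    using assms that by (intro abp_width_pos) (auto simp: sum_smabp_def sm_abp_def split: prod.splits)
  then have "sum_list (map (\<lambda>_. 1) As) \<le> sum_list (map abp_width As)"
    by (rule sum_list_mono)
  then show ?thesis by (simp add: sm_total_width_def sum_list_triv)
qed

section \<open>Asymptotics and the choice of constants\<close>

text \<open>The exponent \<open>d div b\<close> exceeds d/b - 1. Half of d/b is given away to absorb
  the factor \<open>2 * (d + 1)\<close>.\<close>

lemma eventually_exp_dominates:
  fixes b :: nat
  assumes "b > 0"
  shows "\<forall>\<^sub>F d in sequentially. 2 powr (1 / (2 * b) * real d) * (real d + 1) \<le> 2 ^ (d div b)"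
proof -
  define \<delta> where "\<delta> = 1 / (2 * real b)"
  have "\<delta> > 0" using assms by (simp add: \<delta>_def)
  then have "\<forall>\<^sub>F d in sequentially. 2 * (real d + 1) \<le> 2 powr (\<delta> * real d)"
    by real_asymp
  then show ?thesis
  proof eventually_elim
    case (elim d)
    have "2 * (2 powr (\<delta> * d) * (real d + 1)) \<le> 2 powr (\<delta> * d) * 2 powr (\<delta> * d)"
      using mult_left_mono[OF elim, of "2 powr (\<delta> * d)"] by (simp add: algebra_simps)
    also have "\<dots> = 2 powr (real d / b)"
      by (simp add: \<delta>_def flip: powr_add)
    also have "\<dots> \<le> 2 powr (real (d div b) + 1)"
    proof (rule powr_mono)
      have "d \<le> (d div b + 1) * b"
        using dividend_less_div_times[OF assms, of d] by simp
      then have "real d \<le> real ((d div b + 1) * b)" by (rule of_nat_mono)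
      then show "real d / b \<le> real (d div b) + 1"
        using assms by (simp add: field_simps)
    qed simp
    also have "\<dots> = 2 * 2 ^ (d div b)"
      by (simp add: powr_add powr_realpow)
    finally show ?case by (simp add: \<delta>_def)
  qed
qed

theorem theorem1p7:
  "\<exists>(XG :: nat \<Rightarrow> nat \<Rightarrow> nat set list \<times> 'k::field mpoly) (k::nat).
     \<forall>c::nat. \<exists>\<epsilon>::real. \<epsilon> > 0 \<and>
       (\<forall>dfun :: nat \<Rightarrow> nat.
          filterlim (\<lambda>n. real (dfun n) / ln (real n)) at_top sequentially \<longrightarrow>
          (\<forall>\<^sub>F n in sequentially. dfun n \<le> n \<longrightarrow>
             (let d = dfun n; X = fst (XG n d); G = snd (XG n d) in
                length X = d \<and> is_var_partition n X \<and> set_multilinear X G \<and>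
                (\<exists>A. abp_wf A \<and> abp_poly A = G \<and> abp_size A \<le> n ^ k) \<and>
                (\<forall>As. sum_smabp X As \<and> sum_abp_poly As = G \<and> sm_max_width As \<le> n ^ c
                      \<longrightarrow> 2 powr (\<epsilon> * real d) \<le> real (sm_total_width As)))))"
proof (intro exI[of _ "\<lambda>n d. (var_blocks n d, hard_poly n d)"] exI[of _ "5 :: nat"] allI)
  fix c :: nat
  \<comment> \<open>This \<open>m\<close> meets the condition on the block length for
    \<open>e = 4 * c + 1\<close>. As \<open>b\<close> depends on \<open>c\<close> alone,
    \<open>1 / (2 * b)\<close> can serve as \<epsilon>.\<close>
  define m where "m = (128 * (4 * c + 1)) ^ 2"
  define b where "b = 2 * m"
  have b: "b > 0" by (simp add: b_def m_def)
  show "\<exists>\<epsilon>>0. \<forall>dfun :: nat \<Rightarrow> nat.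
          filterlim (\<lambda>n. real (dfun n) / ln (real n)) at_top sequentially \<longrightarrow>
          (\<forall>\<^sub>F n in sequentially. dfun n \<le> n \<longrightarrow>
             (let d = dfun n; X = fst (var_blocks n d, hard_poly n d :: 'k mpoly);
                  G = snd (var_blocks n d, hard_poly n d :: 'k mpoly) in
                length X = d \<and> is_var_partition n X \<and> set_multilinear X G \<and>
                (\<exists>A. abp_wf A \<and> abp_poly A = G \<and> abp_size A \<le> n ^ 5) \<and>
                (\<forall>As. sum_smabp X As \<and> sum_abp_poly As = G \<and> sm_max_width As \<le> n ^ c
                      \<longrightarrow> 2 powr (\<epsilon> * real d) \<le> real (sm_total_width As))))"
  proof (intro exI[of _ "1 / (2 * real b)"] conjI allI impI)
    fix dfun :: "nat \<Rightarrow> nat"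
    assume lim: "filterlim (\<lambda>n. real (dfun n) / ln (real n)) at_top sequentially"
    \<comment> \<open>As \<open>d\<close> outgrows \<open>ln n\<close>, it tends to infinity, so
      that statements about large \<open>d\<close> hold for all large \<open>n\<close>.\<close>
    have "filterlim (\<lambda>n. real (dfun n) / ln (real n) * ln (real n)) at_top sequentially"
      by (rule filterlim_at_top_mult_at_top[OF lim]) real_asymp
    moreover have "\<forall>\<^sub>F n in sequentially. real (dfun n) / ln (real n) * ln (real n) = real (dfun n)"
      using eventually_gt_at_top[of 1] by eventually_elim simp
    ultimately have "filterlim (\<lambda>n. real (dfun n)) at_top sequentially"
      by (simp cong: filterlim_cong)
    then have d_lim: "filterlim dfun at_top sequentially"
      by (simp add: filterlim_sequentially_iff_filterlim_real)
    have "\<forall>\<^sub>F n in sequentially. 2 powr (1 / (2 * b) * real (dfun n)) * (real (dfun n) + 1) \<le> 2 ^ (dfun n div b)"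
      using d_lim eventually_exp_dominates[OF b] by (rule eventually_compose_filterlim[rotated])
    moreover have "\<forall>\<^sub>F n in sequentially. b \<le> dfun n"
      using d_lim by (simp add: filterlim_at_top)
    moreover have "\<forall>\<^sub>F n :: nat in sequentially. 3 \<le> n" by (rule eventually_ge_at_top)
    ultimately show "\<forall>\<^sub>F n in sequentially. dfun n \<le> n \<longrightarrow>
       (let d = dfun n; X = fst (var_blocks n d, hard_poly n d :: 'k mpoly);
            G = snd (var_blocks n d, hard_poly n d :: 'k mpoly) in
          length X = d \<and> is_var_partition n X \<and> set_multilinear X G \<and>
          (\<exists>A. abp_wf A \<and> abp_poly A = G \<and> abp_size A \<le> n ^ 5) \<and>
          (\<forall>As. sum_smabp X As \<and> sum_abp_poly As = G \<and> sm_max_width As \<le> n ^ c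
                \<longrightarrow> 2 powr (1 / (2 * real b) * real d) \<le> real (sm_total_width As)))"
    proof eventually_elim
      case (elim n)
      define d where "d = dfun n"
      have size: "\<exists>A. abp_wf A \<and> abp_poly A = (hard_poly n d :: 'k mpoly) \<and> abp_size A \<le> n ^ 5" if "d \<le> n"
      proof -
        obtain A where A: "abp_wf A" "abp_poly A = (hard_poly n d :: 'k mpoly)"
            "abp_size A \<le> (d + 1) * (Suc (d div 2) * n)"
          using hard_poly_abp[of d n] elim b by (auto simp: d_def)
        \<comment> \<open>The exponent 5 comes from the bounds \<open>n ^ 2\<close>,
          \<open>n ^ 2\<close> and \<open>n\<close> for the three factors of the size.\<close>
        have "d + 1 \<le> n ^ 2" "Suc (d div 2) \<le> n ^ 2"
          using that elim(3) by (auto simp: power2_eq_square intro: order_trans[of _ "3 * n"])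
        then have "(d + 1) * (Suc (d div 2) * n) \<le> n ^ 2 * (n ^ 2 * n)"
          by (intro mult_mono) auto
        also have "\<dots> = n ^ 5" by (simp add: eval_nat_numeral)
        finally show ?thesis using A by (meson order_trans)
      qed
      have width: "2 powr (1 / (2 * real b) * real d) \<le> real (sm_total_width As)"
        if "sum_smabp (var_blocks n d) As" "sum_abp_poly As = (hard_poly n d :: 'k mpoly)"
          "sm_max_width As \<le> n ^ c" for As
      proof -
        have "2 ^ (d div b) \<le> length As * (d + 1)"
          using that elim b by (intro sum_smabp_hard_poly_lower_bound[of n d As c b m])
            (auto simp: d_def b_def m_def)
        also have "\<dots> \<le> sm_total_width As * (d + 1)"
          by (intro mult_right_mono length_le_sm_total_width[OF that(1)]) simp
        finally have "real (2 ^ (d div b)) \<le> real (sm_total_width As * (d + 1))"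
          by (rule of_nat_mono)
        then have "2 powr (1 / (2 * real b) * real d) * (real d + 1) \<le> real (sm_total_width As) * (real d + 1)"
          using elim(1) by (simp add: d_def algebra_simps)
        then show ?thesis by simp
      qed
      show ?case
        using size width by (auto simp: Let_def d_def[symmetric] is_var_partition_var_blocks set_multilinear_hard_poly)
    qed
  qed (use b in simp)
qed

end
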